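(* Let $M$ be a smooth manifold with reference metric $\bar g$ and reference covariant derivative (affine connection) $\bar\nabla$ on $TM$, and let $P$ be an admissible dilation--shear deformation field over $(M,\bar g)$. Represent each vector field $V$ of the deformed space by its reference representative $\bar V=PV$, with induced metric $g(V,W)=\bar g(PV,PW)$, and let the reference representatives be compared by $\bar\nabla$. Then the pulled-back rule $$\nabla V=P^{-1}\bar\nabla(PV)$$ is a covariant derivative on the deformed space (that is, an affine connection on $TM$), and its local connection coefficients are $$\Gamma=P^{-1}\bar\Gamma P+P^{-1}dP,$$ where $\bar\Gamma$ denotes the local connection coefficients of $\bar\nabla$. Equivalently, the natural parallel condition $\bar\nabla(PV)=0$ is $$dV+\Gamma V=0,\qquad \Gamma=\Lambda=P^{-1}\bar\Gamma P+P^{-1}dP .$$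
   Context: $M$ is a smooth $n$-dimensional manifold and $\bar g$ a Riemannian or pseudo-Riemannian metric. A deformation field $P$ is a smooth, pointwise invertible $(1,1)$-tensor field, i.e. a smooth bundle automorphism of $TM$ covering the identity. When $\bar g$ is positive-definite, $P$ is admissible over $(M,\bar g)$ if it is $\bar g$-self-adjoint, $\bar g(PX,Y)=\bar g(X,PY)$ for all $X,Y$, and positive-definite. In indefinite signature no further explicit pointwise condition beyond invertibility is specified: the class of admissible fields is part of the given data. The rule $\nabla V=P^{-1}\bar\nabla(PV)$ means $\nabla_XV=P^{-1}\bar\nabla_X(PV)$ for all vector fields $X$. Local notation: over an open set, fix a local frame $(f_A)$ of $TM$ used for reference representatives and a local frame $(e_\mu)$ used for deformed-space vectors (possibly the same frame). Then $V$ is a column of component functions $V^\mu$ in $(e_\mu)$, $P$ is the matrix $(P^A{}_\mu)$ with $P e_\mu=P^A{}_\mu f_A$, $dV$ and $dP$ are entrywise exterior derivatives, $\bar\Gamma$ is the matrix of connection one-forms of $\bar\nabla$ in the frame $(f_A)$, so that $\bar\nabla\bar V=d\bar V+\bar\Gamma\bar V$ in components, and $\Gamma$ is the matrix of connection one-forms of $\nabla$ in the frame $(e_\mu)$, so that $\nabla V=dV+\Gamma V$. The symbol $\Lambda$ (total natural dilation--shear compensation) is by definition another name for $\Gamma$. *)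

theory Defs
  imports "HOL-Analysis.Analysis"
begin

section \<open>Smooth maps between open subsets of Euclidean spaces\<close>

text \<open>Both notions are meant for open \<open>S\<close> only. In finite dimensions, having continuous
  directional derivatives up to order \<open>k\<close> is the usual \<open>C\<^sup>k\<close> condition.\<close>

primrec Ck_on ::
    "nat \<Rightarrow> 'a::euclidean_space set \<Rightarrow> ('a \<Rightarrow> 'b::real_normed_vector) \<Rightarrow> bool" where
  "Ck_on 0 S f \<longleftrightarrow> continuous_on S f"
| "Ck_on (Suc k) S f \<longleftrightarrow>
     (\<forall>x\<in>S. f differentiable (at x)) \<and>
     (\<forall>v. Ck_on k S (\<lambda>x. frechet_derivative f (at x) v))"

definition smooth_on ::
    "'a::euclidean_space set \<Rightarrow> ('a \<Rightarrow> 'b::real_normed_vector) \<Rightarrow> bool" where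
  "smooth_on S f \<longleftrightarrow> (\<forall>k. Ck_on k S f)"


section \<open>Smooth manifolds\<close>

text \<open>A chart is a pair of its domain and its coordinate map; the values of the map outside the
  domain are irrelevant. The manifold is the whole point type, which is Hausdorff and second
  countable by its sort, together with a smooth atlas. Its dimension is the cardinality
  of \<open>'n\<close>.\<close>

type_synonym ('a, 'n) chart = "'a set \<times> ('a \<Rightarrow> real ^ 'n)"

abbreviation chart_inv :: "('a, 'n::finite) chart \<Rightarrow> real ^ 'n \<Rightarrow> 'a" where
  "chart_inv c \<equiv> inv_into (fst c) (snd c)"

definition is_chart :: "('a::topological_space, 'n::finite) chart \<Rightarrow> bool" where
  "is_chart c \<longleftrightarrow>
     open (fst c) \<and> open (snd c ` fst c) \<and>
     homeomorphism (fst c) (snd c ` fst c) (snd c) (chart_inv c)"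

definition smooth_atlas ::
    "('a::{t2_space, second_countable_topology}, 'n::finite) chart set \<Rightarrow> bool" where
  "smooth_atlas \<A> \<longleftrightarrow>
     (\<forall>c\<in>\<A>. is_chart c) \<and>
     (\<Union>c\<in>\<A>. fst c) = UNIV \<and>
     (\<forall>c\<in>\<A>. \<forall>c'\<in>\<A>. smooth_on (snd c ` (fst c \<inter> fst c')) (snd c' \<circ> chart_inv c))"

definition smooth_fun ::
    "('a::topological_space, 'n::finite) chart set \<Rightarrow> 'a set \<Rightarrow> ('a \<Rightarrow> real) \<Rightarrow> bool" where
  "smooth_fun \<A> U h \<longleftrightarrow> (\<forall>c\<in>\<A>. smooth_on (snd c ` (fst c \<inter> U)) (h \<circ> chart_inv c))"


section \<open>Tangent vectors and vector fields\<close>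

text \<open>A tangent vector at \<open>p\<close> is given by its coordinate vectors in all charts around \<open>p\<close>,
  related by the Jacobians of the transition maps. The coordinates in all other charts
  are set to zero, so that they carry no information.\<close>

datatype ('a, 'n::finite) tvec = Tvec (coord: "('a, 'n) chart \<Rightarrow> real ^ 'n")

instantiation tvec :: (type, finite) real_vector
begin

definition "0 = Tvec (\<lambda>c. 0)"
definition "v + w = Tvec (\<lambda>c. coord v c + coord w c)"
definition "- v = Tvec (\<lambda>c. - coord v c)"
definition "v - w = Tvec (\<lambda>c. coord v c - coord w c)"
definition "a *\<^sub>R v = Tvec (\<lambda>c. a *\<^sub>R coord v c)"

instance
  by standard
    (auto simp: zero_tvec_def plus_tvec_def uminus_tvec_def minus_tvec_def scaleR_tvec_def
      algebra_simps)

end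

definition tangent_space ::
    "('a::topological_space, 'n::finite) chart set \<Rightarrow> 'a \<Rightarrow> ('a, 'n) tvec set" where
  "tangent_space \<A> p = {v.
     (\<forall>c\<in>\<A>. \<forall>c'\<in>\<A>. p \<in> fst c \<and> p \<in> fst c' \<longrightarrow>
        coord v c' = frechet_derivative (snd c' \<circ> chart_inv c) (at (snd c p)) (coord v c)) \<and>
     (\<forall>c. \<not> (c \<in> \<A> \<and> p \<in> fst c) \<longrightarrow> coord v c = 0)}"

type_synonym ('a, 'n) vfield = "'a \<Rightarrow> ('a, 'n) tvec"

definition smooth_vfield ::
    "('a::topological_space, 'n::finite) chart set \<Rightarrow> 'a set \<Rightarrow> ('a, 'n) vfield \<Rightarrow> bool" where
  "smooth_vfield \<A> U V \<longleftrightarrow>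
     (\<forall>p\<in>U. V p \<in> tangent_space \<A> p) \<and>
     (\<forall>c\<in>\<A>. smooth_on (snd c ` (fst c \<inter> U)) ((\<lambda>p. coord (V p) c) \<circ> chart_inv c))"

text \<open>The differential of a function at \<open>p\<close>, applied to \<open>v\<close> in the tangent space at \<open>p\<close>. By the
  chain rule it does not depend on the chart. For vector- and matrix-valued functions it is
  the entrywise exterior derivative.\<close>

definition differential ::
    "('a::topological_space, 'n::finite) chart set \<Rightarrow> ('a \<Rightarrow> 'b::real_normed_vector)
      \<Rightarrow> 'a \<Rightarrow> ('a, 'n) tvec \<Rightarrow> 'b" where
  "differential \<A> h p v =
     (let c = (SOME c. c \<in> \<A> \<and> p \<in> fst c)
      in frechet_derivative (h \<circ> chart_inv c) (at (snd c p)) (coord v c))"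


section \<open>Metrics and deformation fields\<close>

text \<open>Riemannian metrics are included. Smoothness of a tensor field is expressed through its
  action on smooth local vector fields.\<close>

definition pseudo_riemannian_metric ::
    "('a::topological_space, 'n::finite) chart set
      \<Rightarrow> ('a \<Rightarrow> ('a, 'n) tvec \<Rightarrow> ('a, 'n) tvec \<Rightarrow> real) \<Rightarrow> bool" where
  "pseudo_riemannian_metric \<A> g \<longleftrightarrow>
     (\<forall>p. \<forall>u\<in>tangent_space \<A> p. \<forall>v\<in>tangent_space \<A> p. \<forall>w\<in>tangent_space \<A> p. \<forall>a b.
        g p (a *\<^sub>R u + b *\<^sub>R v) w = a * g p u w + b * g p v w) \<and>
     (\<forall>p. \<forall>v\<in>tangent_space \<A> p. \<forall>w\<in>tangent_space \<A> p. g p v w = g p w v) \<and>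
     (\<forall>p. \<forall>v\<in>tangent_space \<A> p. (\<forall>w\<in>tangent_space \<A> p. g p v w = 0) \<longrightarrow> v = 0) \<and>
     (\<forall>U X Y. open U \<and> smooth_vfield \<A> U X \<and> smooth_vfield \<A> U Y \<longrightarrow>
        smooth_fun \<A> U (\<lambda>p. g p (X p) (Y p)))"

definition positive_definite_metric ::
    "('a::topological_space, 'n::finite) chart set
      \<Rightarrow> ('a \<Rightarrow> ('a, 'n) tvec \<Rightarrow> ('a, 'n) tvec \<Rightarrow> real) \<Rightarrow> bool" where
  "positive_definite_metric \<A> g \<longleftrightarrow> (\<forall>p. \<forall>v\<in>tangent_space \<A> p. v \<noteq> 0 \<longrightarrow> 0 < g p v v)"

type_synonym ('a, 'n) endo_field = "'a \<Rightarrow> ('a, 'n) tvec \<Rightarrow> ('a, 'n) tvec"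

definition deformation_field ::
    "('a::topological_space, 'n::finite) chart set \<Rightarrow> ('a, 'n) endo_field \<Rightarrow> bool" where
  "deformation_field \<A> P \<longleftrightarrow>
     (\<forall>p. \<forall>v\<in>tangent_space \<A> p. \<forall>w\<in>tangent_space \<A> p. \<forall>a b.
        P p (a *\<^sub>R v + b *\<^sub>R w) = a *\<^sub>R P p v + b *\<^sub>R P p w) \<and>
     (\<forall>p. bij_betw (P p) (tangent_space \<A> p) (tangent_space \<A> p)) \<and>
     (\<forall>U V. open U \<and> smooth_vfield \<A> U V \<longrightarrow> smooth_vfield \<A> U (\<lambda>p. P p (V p)))"

text \<open>In indefinite signature the class of admissible fields is a datum, here the set \<open>\<D>\<close>,
  about which nothing is assumed.\<close>

definition admissible ::
    "('a::topological_space, 'n::finite) chart set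
      \<Rightarrow> ('a \<Rightarrow> ('a, 'n) tvec \<Rightarrow> ('a, 'n) tvec \<Rightarrow> real)
      \<Rightarrow> ('a, 'n) endo_field set \<Rightarrow> ('a, 'n) endo_field \<Rightarrow> bool" where
  "admissible \<A> g \<D> P \<longleftrightarrow>
     deformation_field \<A> P \<and>
     (if positive_definite_metric \<A> g
      then (\<forall>p. \<forall>v\<in>tangent_space \<A> p. \<forall>w\<in>tangent_space \<A> p. g p (P p v) w = g p v (P p w)) \<and>
           (\<forall>p. \<forall>v\<in>tangent_space \<A> p. v \<noteq> 0 \<longrightarrow> 0 < g p (P p v) v)
      else P \<in> \<D>)"

definition reference_rep ::
    "('a, 'n::finite) endo_field \<Rightarrow> ('a, 'n) vfield \<Rightarrow> ('a, 'n) vfield" where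
  "reference_rep P V = (\<lambda>p. P p (V p))"

definition induced_metric ::
    "('a \<Rightarrow> ('a, 'n::finite) tvec \<Rightarrow> ('a, 'n) tvec \<Rightarrow> real) \<Rightarrow> ('a, 'n) endo_field
      \<Rightarrow> 'a \<Rightarrow> ('a, 'n) tvec \<Rightarrow> ('a, 'n) tvec \<Rightarrow> real" where
  "induced_metric g P = (\<lambda>p v w. g p (P p v) (P p w))"


section \<open>Affine connections\<close>

type_synonym ('a, 'n) covd = "('a, 'n) vfield \<Rightarrow> ('a, 'n) vfield \<Rightarrow> ('a, 'n) vfield"

definition affine_connection ::
    "('a::topological_space, 'n::finite) chart set \<Rightarrow> ('a, 'n) covd \<Rightarrow> bool" where
  "affine_connection \<A> D \<longleftrightarrow>
     (\<forall>X V. smooth_vfield \<A> UNIV X \<and> smooth_vfield \<A> UNIV V \<longrightarrow>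
        smooth_vfield \<A> UNIV (D X V)) \<and>
     (\<forall>X Y V h k. smooth_vfield \<A> UNIV X \<and> smooth_vfield \<A> UNIV Y \<and> smooth_vfield \<A> UNIV V \<and>
        smooth_fun \<A> UNIV h \<and> smooth_fun \<A> UNIV k \<longrightarrow>
        D (\<lambda>p. h p *\<^sub>R X p + k p *\<^sub>R Y p) V = (\<lambda>p. h p *\<^sub>R D X V p + k p *\<^sub>R D Y V p)) \<and>
     (\<forall>X V W a b. smooth_vfield \<A> UNIV X \<and> smooth_vfield \<A> UNIV V \<and> smooth_vfield \<A> UNIV W \<longrightarrow>
        D X (\<lambda>p. a *\<^sub>R V p + b *\<^sub>R W p) = (\<lambda>p. a *\<^sub>R D X V p + b *\<^sub>R D X W p)) \<and>
     (\<forall>X V h. smooth_vfield \<A> UNIV X \<and> smooth_vfield \<A> UNIV V \<and> smooth_fun \<A> UNIV h \<longrightarrow>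
        D X (\<lambda>p. h p *\<^sub>R V p) = (\<lambda>p. differential \<A> h p (X p) *\<^sub>R V p + h p *\<^sub>R D X V p))"

text \<open>The covariant derivative at \<open>p\<close> of a field \<open>V\<close> that is only smooth near \<open>p\<close>, in the direction of
  a tangent vector \<open>v\<close> at \<open>p\<close>: extend both to global smooth fields. For an affine connection the
  result does not depend on the extensions.\<close>

definition local_covd ::
    "('a::topological_space, 'n::finite) chart set \<Rightarrow> ('a, 'n) covd
      \<Rightarrow> 'a \<Rightarrow> ('a, 'n) tvec \<Rightarrow> ('a, 'n) vfield \<Rightarrow> ('a, 'n) tvec" where
  "local_covd \<A> D p v V = (THE w. \<exists>X W N.
     smooth_vfield \<A> UNIV X \<and> X p = v \<and>
     smooth_vfield \<A> UNIV W \<and> open N \<and> p \<in> N \<and> (\<forall>q\<in>N. W q = V q) \<and>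
     w = D X W p)"

definition deformed_connection ::
    "('a::topological_space, 'n::finite) chart set \<Rightarrow> ('a, 'n) endo_field
      \<Rightarrow> ('a, 'n) covd \<Rightarrow> ('a, 'n) covd" where
  "deformed_connection \<A> P D =
     (\<lambda>X V p. inv_into (tangent_space \<A> p) (P p) (D X (reference_rep P V) p))"


section \<open>Local frames and connection one-forms\<close>

definition local_frame ::
    "('a::topological_space, 'n::finite) chart set \<Rightarrow> 'a set \<Rightarrow> ('n \<Rightarrow> ('a, 'n) vfield) \<Rightarrow> bool" where
  "local_frame \<A> U e \<longleftrightarrow>
     (\<forall>i. smooth_vfield \<A> U (e i)) \<and>
     (\<forall>p\<in>U. inj (\<lambda>i. e i p) \<and> independent (range (\<lambda>i. e i p)) \<and>
        span (range (\<lambda>i. e i p)) = tangent_space \<A> p)"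

definition frame_coords ::
    "('n::finite \<Rightarrow> ('a, 'n) vfield) \<Rightarrow> 'a \<Rightarrow> ('a, 'n) tvec \<Rightarrow> real ^ 'n" where
  "frame_coords e p v = (\<chi> i. representation (range (\<lambda>j. e j p)) v (e i p))"

text \<open>The matrix \<open>P\<^sup>A\<^sub>\<mu>\<close> with \<open>P e\<^sub>\<mu> = P\<^sup>A\<^sub>\<mu> f\<^sub>A\<close>; the row index is \<open>A\<close>.\<close>

definition frame_matrix ::
    "('n::finite \<Rightarrow> ('a, 'n) vfield) \<Rightarrow> ('n \<Rightarrow> ('a, 'n) vfield) \<Rightarrow> ('a, 'n) endo_field
      \<Rightarrow> 'a \<Rightarrow> real ^ 'n ^ 'n" where
  "frame_matrix f e P p = (\<chi> A \<mu>. frame_coords f p (P p (e \<mu> p)) $ A)"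

text \<open>The matrix of connection one-forms, evaluated on a tangent vector \<open>v\<close> at \<open>p\<close>: column \<open>\<nu>\<close> holds the
  frame components of the derivative of \<open>e\<^sub>\<nu>\<close> in direction \<open>v\<close>.\<close>

definition connection_form ::
    "('a::topological_space, 'n::finite) chart set \<Rightarrow> ('a, 'n) covd \<Rightarrow> ('n \<Rightarrow> ('a, 'n) vfield)
      \<Rightarrow> 'a \<Rightarrow> ('a, 'n) tvec \<Rightarrow> real ^ 'n ^ 'n" where
  "connection_form \<A> D e p v = (\<chi> \<mu> \<nu>. frame_coords e p (local_covd \<A> D p v (e \<nu>)) $ \<mu>)"

text \<open>The total natural dilation-shear compensation is another name for the connection one-forms
  of the deformed connection.\<close>

definition compensation ::
    "('a::topological_space, 'n::finite) chart set \<Rightarrow> ('a, 'n) endo_field \<Rightarrow> ('a, 'n) covd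
      \<Rightarrow> ('n \<Rightarrow> ('a, 'n) vfield) \<Rightarrow> 'a \<Rightarrow> ('a, 'n) tvec \<Rightarrow> real ^ 'n ^ 'n" where
  "compensation \<A> P D e = connection_form \<A> (deformed_connection \<A> P D) e"

end

theory Submission
  imports Defs
begin

text \<open>All clauses of a connection for \<open>P\<^sup>-\<^sup>1 D P\<close> follow from the linearity of \<open>P\<close>, except that \<open>P\<^sup>-\<^sup>1\<close> has to
  preserve smoothness: if \<open>e\<close> is a local frame, so is \<open>P e\<close>, and \<open>P\<^sup>-\<^sup>1\<close> maps a field with components
  \<open>a\<^sup>i\<close> in \<open>P e\<close> to the field with the same components in \<open>e\<close>.

  The local covariant derivative is well defined because a connection is local (Leibniz rule for a
  bump function) and tensorial in the direction. The compensation formula is then the \<open>f\<close>-component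
  of \<open>P (\<nabla>\<^sub>v e\<^sub>\<nu>) = D\<^sub>v (P e\<^sub>\<nu>) = D\<^sub>v (P\<^sup>A\<^sub>\<nu> f\<^sub>A)\<close>, which reads \<open>M \<Gamma> = \<Gamma>bar M + dM\<close> for the matrix \<open>M\<close> of
  \<open>P\<close>; the parallel condition follows
  in the same way, since \<open>P\<close> is injective.\<close>

section \<open>Calculus of smooth maps\<close>

text \<open>The obstacle is that \<open>affine_connection\<close> constrains \<open>D\<close> on
  global smooth fields only, whereas frames, connection forms and the parallel condition live on an
  open set. Each passage from local to global multiplies by a bump function and extends by zero. For
  the extension to be smooth, the bump must vanish off a set that is closed in the whole manifold;
  this is where the Hausdorff property enters, since a compact subset of a chart domain is then
  closed. The bumps come from the flatness of exp(-1/t) at 0, hence the amount of Euclidean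
  calculus. A second theme is to keep \<open>P\<close> on the left as long as possible: identities
  are proved in the form \<open>P p (local_covd ...) = ...\<close>, so no derivative of the inverse
  of \<open>P\<close> is ever computed. That the inverse preserves smoothness enters only in showing
  that the pulled-back rule is a connection.\<close>

lemma Ck_on_SucD:
  assumes "Ck_on (Suc k) S f"
  shows "x \<in> S \<Longrightarrow> (f has_derivative frechet_derivative f (at x)) (at x)"
    and "Ck_on k S (\<lambda>x. frechet_derivative f (at x) v)"
  using assms by (auto simp: frechet_derivative_works)

text \<open>Openness makes \<open>f\<close> and \<open>g\<close> agree near every point of
  \<open>S\<close>, so they have the same derivative there, and the induction continues with their
  directional derivatives in place of \<open>f\<close> and \<open>g\<close>.\<close>

lemma Ck_on_cong:
  assumes "open S" "\<And>x. x \<in> S \<Longrightarrow> f x = g x" "Ck_on k S f"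
  shows "Ck_on k S g"
  using assms(2,3)
proof (induction k arbitrary: f g)
  case 0
  then show ?case by (auto cong: continuous_on_cong)
next
  case (Suc k)
  have d: "(g has_derivative frechet_derivative f (at x)) (at x)" if "x \<in> S" for x
    using has_derivative_transform_within_open[OF Ck_on_SucD(1)[OF Suc.prems(2) that] assms(1) that]
      Suc.prems(1) by blast
  have e: "frechet_derivative f (at x) = frechet_derivative g (at x)" if "x \<in> S" for x
    using frechet_derivative_at[OF d[OF that]] by simp
  have "Ck_on k S (\<lambda>x. frechet_derivative g (at x) v)" for v
    by (rule Suc.IH[OF _ Ck_on_SucD(2)[OF Suc.prems(2), of v]]) (simp add: e)
  then show ?case using d by (auto simp: differentiable_def)
qed

text \<open>Replaces \<open>frechet_derivative\<close>, which is defined by choice, by any explicit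
  derivative. Most closure properties below take their inductive step through it.\<close>

lemma Ck_on_SucI:
  assumes "open S" "\<And>x. x \<in> S \<Longrightarrow> (f has_derivative f' x) (at x)"
    and "\<And>v. Ck_on k S (\<lambda>x. f' x v)"
  shows "Ck_on (Suc k) S f"
proof -
  have "Ck_on k S (\<lambda>x. frechet_derivative f (at x) v)" for v
    by (rule Ck_on_cong[OF assms(1) _ assms(3)[of v]])
      (use frechet_derivative_at[OF assms(2)] in auto)
  then show ?thesis using assms(2) by (auto simp: differentiable_def)
qed

text \<open>Product and chain rules leave an undifferentiated factor, for which the induction
  hypothesis requires the lower order.\<close>

lemma Ck_on_SucD_Ck: "Ck_on (Suc k) S f \<Longrightarrow> Ck_on k S f"
proof (induction k arbitrary: f)
  case 0
  then show ?case
    by (auto intro!: continuous_at_imp_continuous_on differentiable_imp_continuous_within)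
next
  case (Suc k)
  then show ?case by (metis Ck_on.simps(2))
qed

lemma Ck_on_subset: "Ck_on k T f \<Longrightarrow> S \<subseteq> T \<Longrightarrow> Ck_on k S f"
  by (induction k arbitrary: f) (auto intro: continuous_on_subset)

text \<open>The derivatives in \<open>Ck_on\<close> are taken at \<open>x\<close> in the full space,
  not within \<open>S\<close>, so a neighbourhood of each point decides. Maps glued from pieces are
  handled this way.\<close>

lemma Ck_on_local:
  assumes "\<And>x. x \<in> S \<Longrightarrow> \<exists>T. open T \<and> x \<in> T \<and> Ck_on k T f"
  shows "Ck_on k S f"
  using assms
proof (induction k arbitrary: f)
  case 0
  then show ?case
    by (metis Ck_on.simps(1) continuous_at_imp_continuous_on continuous_on_eq_continuous_at)
next
  case (Suc k)
  have "Ck_on k S (\<lambda>x. frechet_derivative f (at x) v)" for v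
    by (rule Suc.IH) (use Suc.prems in fastforce)
  then show ?case using Suc.prems by fastforce
qed

lemma Ck_on_const: "Ck_on k S (\<lambda>x. c)"
  by (induction k arbitrary: c) auto

lemma Ck_on_bounded_linear:
  assumes "open S" "bounded_linear h" "Ck_on k S f"
  shows "Ck_on k S (\<lambda>x. h (f x))"
  using assms(3)
proof (induction k arbitrary: f)
  case 0
  then show ?case
    using bounded_linear.continuous_on[OF assms(2)] by auto
next
  case (Suc k)
  show ?case
    by (rule Ck_on_SucI[OF assms(1) bounded_linear.has_derivative[OF assms(2)]])
      (use Suc Ck_on_SucD in blast)+
qed

lemma Ck_on_add:
  assumes "open S" "Ck_on k S f" "Ck_on k S g"
  shows "Ck_on k S (\<lambda>x. f x + g x)"
  using assms(2,3)
proof (induction k arbitrary: f g)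
  case 0
  then show ?case by (auto intro: continuous_on_add)
next
  case (Suc k)
  show ?case
    by (rule Ck_on_SucI[OF assms(1) has_derivative_add]) (use Suc Ck_on_SucD in blast)+
qed

text \<open>One induction serves real products, scaling of vectors and inner products: both terms of
  the Leibniz rule are again of the form \<open>b\<close> applied to two maps of class C^k.\<close>

lemma Ck_on_bilinear:
  assumes "open S" "bounded_bilinear b" "Ck_on k S f" "Ck_on k S g"
  shows "Ck_on k S (\<lambda>x. b (f x) (g x))"
  using assms(3,4)
proof (induction k arbitrary: f g)
  case 0
  then show ?case using bounded_bilinear.continuous_on[OF assms(2)] by auto
next
  case (Suc k)
  show ?case
  proof (rule Ck_on_SucI[OF assms(1)])
    show "((\<lambda>x. b (f x) (g x)) has_derivative (\<lambda>v. b (f x) (frechet_derivative g (at x) v)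
        + b (frechet_derivative f (at x) v) (g x))) (at x)" if "x \<in> S" for x
      using Suc.prems[THEN Ck_on_SucD(1), OF that] by (rule bounded_bilinear.FDERIV[OF assms(2)])
    show "Ck_on k S (\<lambda>x. b (f x) (frechet_derivative g (at x) v)
        + b (frechet_derivative f (at x) v) (g x))" for v
      by (intro Ck_on_add[OF assms(1)] Suc.IH Ck_on_SucD_Ck[OF Suc.prems(1)]
          Ck_on_SucD_Ck[OF Suc.prems(2)] Suc.prems[THEN Ck_on_SucD(2)])
  qed
qed

lemma Ck_on_id: "open S \<Longrightarrow> Ck_on k S (\<lambda>x. x)"
proof (cases k)
  case (Suc m)
  assume "open S"
  then show ?thesis
    unfolding Suc by (rule Ck_on_SucI[OF _ has_derivative_ident]) (auto intro: Ck_on_const)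
qed auto

lemma Ck_on_sum:
  assumes "open S" "\<And>i. i \<in> I \<Longrightarrow> Ck_on k S (f i)"
  shows "Ck_on k S (\<lambda>x. \<Sum>i\<in>I. f i x)"
  using assms(2)
  by (induction I rule: infinite_finite_induct) (auto intro: Ck_on_const Ck_on_add[OF assms(1)])

lemma Ck_on_prod:
  fixes f :: "'i \<Rightarrow> 'a::euclidean_space \<Rightarrow> real"
  assumes "open S" "\<And>i. i \<in> I \<Longrightarrow> Ck_on k S (f i)"
  shows "Ck_on k S (\<lambda>x. \<Prod>i\<in>I. f i x)"
  using assms(2)
  by (induction I rule: infinite_finite_induct)
    (auto intro: Ck_on_const Ck_on_bilinear[OF assms(1) bounded_bilinear_mult])

text \<open>The derivative of 1/f contains 1/f itself and no derivative of it, so the induction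
  hypothesis for the same \<open>f\<close> is enough.\<close>

lemma Ck_on_inverse:
  fixes f :: "'a::euclidean_space \<Rightarrow> real"
  assumes "open S" "Ck_on k S f" "\<And>x. x \<in> S \<Longrightarrow> f x \<noteq> 0"
  shows "Ck_on k S (\<lambda>x. inverse (f x))"
  using assms(2)
proof (induction k)
  case 0
  then show ?case using assms(3) by (auto intro: continuous_on_inverse)
next
  case (Suc k)
  note IH = Suc.IH[OF Ck_on_SucD_Ck[OF Suc.prems]]
  note mult = Ck_on_bilinear[OF assms(1) bounded_bilinear_mult]
  show ?case
  proof (rule Ck_on_SucI[OF assms(1)])
    show "((\<lambda>x. inverse (f x)) has_derivative
        (\<lambda>v. - (inverse (f x) * frechet_derivative f (at x) v * inverse (f x)))) (at x)"
      if "x \<in> S" for x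
      using assms(3)[OF that] Ck_on_SucD(1)[OF Suc.prems that] by (rule Deriv.has_derivative_inverse)
    show "Ck_on k S (\<lambda>x. - (inverse (f x) * frechet_derivative f (at x) v * inverse (f x)))" for v
      by (intro Ck_on_bounded_linear[OF assms(1) bounded_linear_minus[OF bounded_linear_ident]]
          mult IH Ck_on_SucD(2)[OF Suc.prems])
  qed
qed

text \<open>In the chain rule the direction fed to the derivative of \<open>g\<close> varies with
  \<open>x\<close>, while \<open>Ck_on\<close> controls fixed directions only. Expanding that
  direction along \<open>Basis\<close> leaves a finite sum of fixed-direction derivatives with
  scalar coefficients of class C^k.\<close>

lemma Ck_on_compose:
  fixes f :: "'a::euclidean_space \<Rightarrow> 'b::euclidean_space"
  assumes "open S" "Ck_on k T g" "Ck_on k S f" "f ` S \<subseteq> T"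
  shows "Ck_on k S (\<lambda>x. g (f x))"
  using assms(2,3)
proof (induction k arbitrary: g)
  case 0
  then show ?case using assms(4) by (auto intro: continuous_on_compose2)
next
  case (Suc k)
  note f = Suc.prems(2) and g = Suc.prems(1)
  let ?df = "\<lambda>x. frechet_derivative f (at x)" and ?dg = "\<lambda>y. frechet_derivative g (at y)"
  have *: "((\<lambda>x. g (f x)) has_derivative (\<lambda>v. \<Sum>b\<in>Basis. (?df x v \<bullet> b) *\<^sub>R ?dg (f x) b)) (at x)"
    if "x \<in> S" for x
  proof -
    have fx: "f x \<in> T" using that assms(4) by auto
    interpret bounded_linear "?dg (f x)"
      using Ck_on_SucD(1)[OF g fx] has_derivative_bounded_linear by blast
    have "?dg (f x) (?df x v) = (\<Sum>b\<in>Basis. (?df x v \<bullet> b) *\<^sub>R ?dg (f x) b)" for v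
      by (subst euclidean_representation[symmetric]) (simp add: sum scaleR)
    then show ?thesis
      using has_derivative_compose[OF Ck_on_SucD(1)[OF f that] Ck_on_SucD(1)[OF g fx]]
      by simp
  qed
  show ?case
  proof (rule Ck_on_SucI[OF assms(1) *])
    fix v
    show "Ck_on k S (\<lambda>x. \<Sum>b\<in>Basis. (?df x v \<bullet> b) *\<^sub>R ?dg (f x) b)"
      by (intro Ck_on_sum Ck_on_bilinear[OF assms(1) bounded_bilinear_scaleR] assms(1)
          Ck_on_bounded_linear[OF assms(1) bounded_linear_inner_left]
          Ck_on_SucD(2)[OF f] Suc.IH[OF Ck_on_SucD(2)[OF g]] Ck_on_SucD_Ck[OF f])
  qed
qed

section \<open>Closure properties of smooth maps\<close>

lemma smooth_on_has_derivative:
  "smooth_on S f \<Longrightarrow> x \<in> S \<Longrightarrow> (f has_derivative frechet_derivative f (at x)) (at x)"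
  unfolding smooth_on_def by (rule Ck_on_SucD(1)[of 0 S]) blast+

lemma smooth_on_frechet_derivative:
  "smooth_on S f \<Longrightarrow> smooth_on S (\<lambda>x. frechet_derivative f (at x) v)"
  unfolding smooth_on_def by (rule allI, rule Ck_on_SucD(2)) (rule spec)

lemma smooth_on_cong:
  "open S \<Longrightarrow> (\<And>x. x \<in> S \<Longrightarrow> f x = g x) \<Longrightarrow> smooth_on S f \<Longrightarrow> smooth_on S g"
  unfolding smooth_on_def by (rule allI, rule Ck_on_cong[where f = f]) auto

lemma smooth_on_subset: "smooth_on T f \<Longrightarrow> S \<subseteq> T \<Longrightarrow> smooth_on S f"
  unfolding smooth_on_def by (rule allI, rule Ck_on_subset[where T = T]) auto

lemma smooth_on_local:
  "(\<And>x. x \<in> S \<Longrightarrow> \<exists>T. open T \<and> x \<in> T \<and> smooth_on T f) \<Longrightarrow> smooth_on S f"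
  unfolding smooth_on_def by (rule allI, rule Ck_on_local) metis

lemma smooth_on_const: "smooth_on S (\<lambda>x. c)"
  unfolding smooth_on_def by (rule allI, rule Ck_on_const)

lemma smooth_on_id: "open S \<Longrightarrow> smooth_on S (\<lambda>x. x)"
  unfolding smooth_on_def by (rule allI, rule Ck_on_id) auto

lemma smooth_on_bounded_linear:
  "open S \<Longrightarrow> bounded_linear h \<Longrightarrow> smooth_on S f \<Longrightarrow> smooth_on S (\<lambda>x. h (f x))"
  unfolding smooth_on_def by (rule allI, rule Ck_on_bounded_linear) auto

lemma smooth_on_add:
  "open S \<Longrightarrow> smooth_on S f \<Longrightarrow> smooth_on S g \<Longrightarrow> smooth_on S (\<lambda>x. f x + g x)"
  unfolding smooth_on_def by (rule allI, rule Ck_on_add) auto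

lemma smooth_on_bilinear:
  "open S \<Longrightarrow> bounded_bilinear b \<Longrightarrow> smooth_on S f \<Longrightarrow> smooth_on S g
    \<Longrightarrow> smooth_on S (\<lambda>x. b (f x) (g x))"
  unfolding smooth_on_def by (rule allI, rule Ck_on_bilinear) auto

lemma smooth_on_sum:
  "open S \<Longrightarrow> (\<And>i. i \<in> I \<Longrightarrow> smooth_on S (f i)) \<Longrightarrow> smooth_on S (\<lambda>x. \<Sum>i\<in>I. f i x)"
  unfolding smooth_on_def by (rule allI, rule Ck_on_sum) auto

lemma smooth_on_prod:
  fixes f :: "'i \<Rightarrow> 'a::euclidean_space \<Rightarrow> real"
  shows "open S \<Longrightarrow> (\<And>i. i \<in> I \<Longrightarrow> smooth_on S (f i)) \<Longrightarrow> smooth_on S (\<lambda>x. \<Prod>i\<in>I. f i x)"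
  unfolding smooth_on_def by (rule allI, rule Ck_on_prod) auto

lemma smooth_on_inverse:
  fixes f :: "'a::euclidean_space \<Rightarrow> real"
  shows "open S \<Longrightarrow> smooth_on S f \<Longrightarrow> (\<And>x. x \<in> S \<Longrightarrow> f x \<noteq> 0)
    \<Longrightarrow> smooth_on S (\<lambda>x. inverse (f x))"
  unfolding smooth_on_def by (rule allI, rule Ck_on_inverse) auto

lemma smooth_on_compose:
  fixes f :: "'a::euclidean_space \<Rightarrow> 'b::euclidean_space"
  shows "open S \<Longrightarrow> smooth_on T g \<Longrightarrow> smooth_on S f \<Longrightarrow> f ` S \<subseteq> T
    \<Longrightarrow> smooth_on S (\<lambda>x. g (f x))"
  unfolding smooth_on_def by (rule allI, rule Ck_on_compose[where T = T]) auto

lemma smooth_on_det: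
  fixes E :: "'a::euclidean_space \<Rightarrow> real ^ 'n ^ 'n"
  assumes "open S" "\<And>i j. smooth_on S (\<lambda>x. E x $ i $ j)"
  shows "smooth_on S (\<lambda>x. det (E x))"
  unfolding det_def
  by (intro smooth_on_sum smooth_on_bilinear[OF assms(1) bounded_bilinear_mult] smooth_on_prod
      smooth_on_const assms)


section \<open>Bump functions\<close>

text \<open>The case \<open>q = 1\<close> is the classical function exp(-1/t). The polynomial factor
  makes the family closed under differentiation, so that smoothness of all its members is a single
  induction.\<close>

definition flat :: "real poly \<Rightarrow> real \<Rightarrow> real" where
  "flat q t = (if t > 0 then poly q (1 / t) * exp (- (1 / t)) else 0)"

text \<open>From the right, x = 1/t turns the claim into the victory of exp(x) over a polynomial at
  infinity; from the left the function is constant.\<close>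

lemma flat_tendsto_0: "(flat q \<longlongrightarrow> 0) (at 0)"
proof -
  have "((\<lambda>x. \<Sum>i\<le>degree q. coeff q i * (x ^ i / exp x)) \<longlongrightarrow> (\<Sum>i\<le>degree q. coeff q i * 0)) at_top"
    by (intro tendsto_intros tendsto_power_div_exp_0)
  then have "((\<lambda>x. poly q x * exp (- x)) \<longlongrightarrow> 0) at_top"
    by (simp add: poly_altdef sum_distrib_right exp_minus divide_inverse mult.assoc)
  from filterlim_compose[OF this filterlim_inverse_at_top_right]
  have "((\<lambda>t. poly q (1 / t) * exp (- (1 / t))) \<longlongrightarrow> 0) (at_right 0)"
    by (simp add: inverse_eq_divide)
  then have "(flat q \<longlongrightarrow> 0) (at_right 0)"
    by (rule Lim_transform_eventually) (auto simp: flat_def eventually_at intro: exI[of _ 1])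
  moreover have "(flat q \<longlongrightarrow> 0) (at_left 0)"
    by (rule Lim_transform_eventually[OF tendsto_const])
      (auto simp: flat_def eventually_at intro: exI[of _ 1])
  ultimately show ?thesis using filterlim_split_at by blast
qed

text \<open>With u = 1/t, the t-derivative of q(u) exp(-u) is u^2 (q(u) - q'(u)) exp(-u), whence the
  polynomial X^2 (q - q').\<close>

lemma flat_has_real_derivative:
  "(flat q has_real_derivative flat ([:0, 0, 1:] * (q - pderiv q)) t) (at t)"
proof -
  consider "t > 0" | "t < 0" | "t = 0" by linarith
  then show ?thesis
  proof cases
    case 1
    have "((\<lambda>t. poly q (1 / t) * exp (- (1 / t))) has_real_derivative
        flat ([:0, 0, 1:] * (q - pderiv q)) t) (at t)"
      using 1 by (auto intro!: derivative_eq_intros simp: flat_def field_simps power2_eq_square)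
    then show ?thesis
      by (rule has_field_derivative_transform_within_open[where S = "{0<..}"])
        (use 1 in \<open>auto simp: flat_def\<close>)
  next
    case 2
    have "((\<lambda>t. 0) has_real_derivative flat ([:0, 0, 1:] * (q - pderiv q)) t) (at t)"
      using 2 by (auto simp: flat_def)
    then show ?thesis
      by (rule has_field_derivative_transform_within_open[where S = "{..<0}"])
        (use 2 in \<open>auto simp: flat_def\<close>)
  next
    case 3
    \<comment> \<open>Dividing by h multiplies the polynomial in 1/h by X, so the difference
      quotient at 0 belongs to the same family and tends to 0.\<close>
    have "(\<lambda>h. (flat q h - flat q 0) / (h - 0)) = flat ([:0, 1:] * q)"
      by (auto simp: flat_def)
    then have "(flat q has_real_derivative 0) (at 0)"
      using flat_tendsto_0 unfolding has_field_derivative_iff by simp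
    then show ?thesis using 3 by (simp add: flat_def)
  qed
qed

lemma smooth_on_flat: "smooth_on UNIV (flat q)"
proof -
  have "Ck_on k UNIV (flat q)" for k
  proof (induction k arbitrary: q)
    case 0
    then show ?case
      by (auto intro!: continuous_at_imp_continuous_on DERIV_isCont[OF flat_has_real_derivative])
  next
    case (Suc k)
    show ?case
      by (rule Ck_on_SucI[OF open_UNIV flat_has_real_derivative[unfolded has_field_derivative_def]])
        (intro Ck_on_bilinear[OF open_UNIV bounded_bilinear_mult] Ck_on_const Suc)
  qed
  then show ?thesis by (simp add: smooth_on_def)
qed

section \<open>Smooth steps and Euclidean bumps\<close>

lemma smooth_step_exists:
  "\<exists>s :: real \<Rightarrow> real. smooth_on UNIV s \<and> (\<forall>t\<le>0. s t = 0) \<and> (\<forall>t\<ge>1. s t = 1)"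
proof (intro exI conjI)
  \<comment> \<open>The denominator is positive because t or 1 - t is positive. For t \<le> 0 the
    numerator vanishes, for t \<ge> 1 the second summand of the denominator does.\<close>
  let ?s = "\<lambda>t. flat 1 t * inverse (flat 1 t + flat 1 (1 + (-1) * t))"
  have pos: "flat 1 t + flat 1 (1 + (-1) * t) > 0" for t
    by (cases "t > 0") (auto simp: flat_def add_pos_pos)
  show "smooth_on UNIV ?s"
    by (intro smooth_on_bilinear[OF open_UNIV bounded_bilinear_mult] smooth_on_inverse
        smooth_on_add smooth_on_flat smooth_on_compose[OF open_UNIV smooth_on_flat]
        smooth_on_id smooth_on_const open_UNIV subset_UNIV less_imp_neq[OF pos, symmetric])
  show "\<forall>t\<le>0. ?s t = 0" "\<forall>t\<ge>1. ?s t = 1" by (auto simp: flat_def)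
qed

lemma smooth_bump_exists:
  fixes a :: "'a::euclidean_space"
  assumes "r > 0"
  shows "\<exists>\<psi> :: 'a \<Rightarrow> real. smooth_on UNIV \<psi> \<and> (\<forall>x\<in>ball a r. \<psi> x = 1) \<and>
    (\<forall>x. x \<notin> cball a (2 * r) \<longrightarrow> \<psi> x = 0)"
proof -
  obtain s :: "real \<Rightarrow> real" where
    s: "smooth_on UNIV s" "\<And>t. t \<le> 0 \<Longrightarrow> s t = 0" "\<And>t. t \<ge> 1 \<Longrightarrow> s t = 1"
    using smooth_step_exists by blast
  let ?n = "\<lambda>x. (x + (- a)) \<bullet> (x + (- a))"
  \<comment> \<open>The argument is 2 - |x - a|^2 / r^2: at least 1 within distance r, and at most
    -2 beyond distance 2r. The square avoids the point where the norm is not differentiable.\<close>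
  let ?\<psi> = "\<lambda>x. s (2 + (- 1 / r\<^sup>2) * ?n x)"
  have n: "?n x = (dist a x)\<^sup>2" for x
    by (simp add: dist_norm power2_norm_eq_inner norm_minus_commute[of a])
  have "smooth_on UNIV ?\<psi>"
    by (intro smooth_on_compose[OF open_UNIV s(1)] smooth_on_add smooth_on_const smooth_on_id
        smooth_on_bilinear[OF open_UNIV bounded_bilinear_mult]
        smooth_on_bilinear[OF open_UNIV bounded_bilinear_inner] open_UNIV subset_UNIV)
  moreover have "?\<psi> x = 1" if "x \<in> ball a r" for x
  proof (rule s(3))
    have "(dist a x)\<^sup>2 \<le> r\<^sup>2" using that by (intro power_mono) auto
    then show "1 \<le> 2 + (- 1 / r\<^sup>2) * ?n x" unfolding n using assms by (simp add: field_simps)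
  qed
  moreover have "?\<psi> x = 0" if "x \<notin> cball a (2 * r)" for x
  proof (rule s(2))
    have "(2 * r)\<^sup>2 \<le> (dist a x)\<^sup>2" using that assms by (intro power_mono) auto
    then have "4 * r\<^sup>2 \<le> (dist a x)\<^sup>2" by (simp add: power_mult_distrib)
    then have "2 * r\<^sup>2 \<le> (dist a x)\<^sup>2" using zero_le_power2[of r] by linarith
    then show "2 + (- 1 / r\<^sup>2) * ?n x \<le> 0" unfolding n using assms by (simp add: field_simps)
  qed
  ultimately show ?thesis by blast
qed

section \<open>Smooth maps on a manifold\<close>

text \<open>\<open>smooth_fun\<close> and \<open>smooth_vfield\<close> both impose this condition in
  every chart, for real values and for coordinate vectors. Fixing the chart and leaving the codomain
  general lets one set of closure rules serve both.\<close>

definition chart_smooth ::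
    "('a::topological_space, 'n::finite) chart \<Rightarrow> 'a set \<Rightarrow> ('a \<Rightarrow> 'b::real_normed_vector) \<Rightarrow> bool"
  where "chart_smooth c U H \<longleftrightarrow> smooth_on (snd c ` (fst c \<inter> U)) (H \<circ> chart_inv c)"

lemma coord_simps [simp]:
  "coord 0 c = 0" "coord (v + w) c = coord v c + coord w c" "coord (- v) c = - coord v c"
  "coord (v - w) c = coord v c - coord w c" "coord (a *\<^sub>R v) c = a *\<^sub>R coord v c"
  by (simp_all add: zero_tvec_def plus_tvec_def uminus_tvec_def minus_tvec_def scaleR_tvec_def)

lemma coord_sum [simp]: "coord (\<Sum>i\<in>I. v i) c = (\<Sum>i\<in>I. coord (v i) c)"
  by (induction I rule: infinite_finite_induct) auto

locale smooth_manifold =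
  fixes \<A> :: "('a::{t2_space, second_countable_topology}, 'n::finite) chart set"
  assumes atlas: "smooth_atlas \<A>"
begin

lemma chart_at: "\<exists>c\<in>\<A>. p \<in> fst c"
  using atlas unfolding smooth_atlas_def by blast

lemma chart_homeomorphism:
  "c \<in> \<A> \<Longrightarrow> homeomorphism (fst c) (snd c ` fst c) (snd c) (chart_inv c)"
  using atlas unfolding smooth_atlas_def is_chart_def by blast

lemma open_chart_dom: "c \<in> \<A> \<Longrightarrow> open (fst c)"
  and open_chart_range: "c \<in> \<A> \<Longrightarrow> open (snd c ` fst c)"
  using atlas unfolding smooth_atlas_def is_chart_def by blast+

lemma chart_inv_left: "c \<in> \<A> \<Longrightarrow> p \<in> fst c \<Longrightarrow> chart_inv c (snd c p) = p"
  using chart_homeomorphism unfolding homeomorphism_def by blast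

lemma open_chart_image:
  assumes "c \<in> \<A>" "open U"
  shows "open (snd c ` (fst c \<inter> U))"
proof -
  have "openin (top_of_set (snd c ` fst c)) (snd c ` (fst c \<inter> U))"
    using homeomorphism_imp_open_map[OF chart_homeomorphism[OF assms(1)]] assms(2)
    by (simp add: openin_open_Int)
  then show ?thesis using open_chart_range[OF assms(1)] openin_open_trans by blast
qed

lemma open_chart_vimage: "c \<in> \<A> \<Longrightarrow> open V \<Longrightarrow> open (fst c \<inter> snd c -` V)"
  using chart_homeomorphism[of c] open_chart_dom[of c] unfolding homeomorphism_def
  by (intro continuous_open_preimage) auto

lemma transition_smooth:
  "c \<in> \<A> \<Longrightarrow> c' \<in> \<A> \<Longrightarrow> smooth_on (snd c ` (fst c \<inter> fst c')) (snd c' \<circ> chart_inv c)"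
  using atlas unfolding smooth_atlas_def by blast

section \<open>Calculus in a single chart\<close>

lemma chart_smooth_subset: "chart_smooth c T H \<Longrightarrow> S \<subseteq> T \<Longrightarrow> chart_smooth c S H"
  unfolding chart_smooth_def by (erule smooth_on_subset) blast

lemma chart_smooth_local:
  assumes "c \<in> \<A>" "\<And>p. p \<in> U \<Longrightarrow> p \<in> fst c \<Longrightarrow> \<exists>N. open N \<and> p \<in> N \<and> chart_smooth c N H"
  shows "chart_smooth c U H"
  unfolding chart_smooth_def
proof (rule smooth_on_local)
  fix x assume "x \<in> snd c ` (fst c \<inter> U)"
  then obtain p where p: "x = snd c p" "p \<in> fst c" "p \<in> U" by blast
  then obtain N where "open N" "p \<in> N" "chart_smooth c N H" using assms(2) by blast
  then show "\<exists>T. open T \<and> x \<in> T \<and> smooth_on T (H \<circ> chart_inv c)"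
    using open_chart_image[OF assms(1)] p unfolding chart_smooth_def by blast
qed

lemma chart_smooth_cong:
  assumes "c \<in> \<A>" "open U" "\<And>p. p \<in> U \<Longrightarrow> p \<in> fst c \<Longrightarrow> H p = G p" "chart_smooth c U H"
  shows "chart_smooth c U G"
  using assms(4) unfolding chart_smooth_def
  by (rule smooth_on_cong[rotated 2])
    (use assms(1,3) open_chart_image[OF assms(1,2)] in \<open>auto simp: chart_inv_left\<close>)

lemma chart_smooth_const: "chart_smooth c U (\<lambda>p. k)"
  unfolding chart_smooth_def comp_def by (rule smooth_on_const)

lemma chart_smooth_bounded_linear:
  assumes "c \<in> \<A>" "open U" "bounded_linear h" "chart_smooth c U H"
  shows "chart_smooth c U (\<lambda>p. h (H p))"
  using assms(4) unfolding chart_smooth_def comp_def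
  by (rule smooth_on_bounded_linear[OF open_chart_image[OF assms(1,2)] assms(3)])

lemma chart_smooth_bilinear:
  assumes "c \<in> \<A>" "open U" "bounded_bilinear b" "chart_smooth c U H" "chart_smooth c U G"
  shows "chart_smooth c U (\<lambda>p. b (H p) (G p))"
  using assms(4,5) unfolding chart_smooth_def comp_def
  by (rule smooth_on_bilinear[OF open_chart_image[OF assms(1,2)] assms(3)])

lemma chart_smooth_add:
  assumes "c \<in> \<A>" "open U" "chart_smooth c U H" "chart_smooth c U G"
  shows "chart_smooth c U (\<lambda>p. H p + G p)"
  using assms(3,4) unfolding chart_smooth_def comp_def
  by (rule smooth_on_add[OF open_chart_image[OF assms(1,2)]])

lemma chart_smooth_sum:
  assumes "c \<in> \<A>" "open U" "\<And>i. i \<in> I \<Longrightarrow> chart_smooth c U (H i)"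
  shows "chart_smooth c U (\<lambda>p. \<Sum>i\<in>I. H i p)"
  using assms(3) unfolding chart_smooth_def comp_def
  by (rule smooth_on_sum[OF open_chart_image[OF assms(1,2)]])

lemma chart_smooth_inverse:
  fixes h :: "'a \<Rightarrow> real"
  assumes "c \<in> \<A>" "open U" "chart_smooth c U h" "\<And>p. p \<in> U \<Longrightarrow> p \<in> fst c \<Longrightarrow> h p \<noteq> 0"
  shows "chart_smooth c U (\<lambda>p. inverse (h p))"
  using assms(3) unfolding chart_smooth_def comp_def
  by (rule smooth_on_inverse[OF open_chart_image[OF assms(1,2)]])
    (use assms(1,4) in \<open>auto simp: chart_inv_left\<close>)

lemma chart_smooth_det:
  fixes E :: "'a \<Rightarrow> real ^ 'm ^ 'm"
  assumes "c \<in> \<A>" "open U" "\<And>i j. chart_smooth c U (\<lambda>p. E p $ i $ j)"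
  shows "chart_smooth c U (\<lambda>p. det (E p))"
  using assms(3) unfolding chart_smooth_def comp_def
  by (rule smooth_on_det[OF open_chart_image[OF assms(1,2)]])

text \<open>Read in the chart \<open>c\<close>, the map is \<open>\<psi>\<close> after a transition
  map, so it is smooth by the compatibility of the atlas.\<close>

lemma chart_smooth_pullback:
  assumes "c \<in> \<A>" "c' \<in> \<A>" "smooth_on (snd c' ` fst c') \<psi>"
  shows "chart_smooth c (fst c') (\<lambda>p. \<psi> (snd c' p))"
  unfolding chart_smooth_def comp_def
  by (rule smooth_on_compose[OF open_chart_image[OF assms(1) open_chart_dom[OF assms(2)]] assms(3)])
    (use transition_smooth[OF assms(1,2)] assms(1) in \<open>auto simp: comp_def chart_inv_left\<close>)

lemma smooth_fun_iff: "smooth_fun \<A> U h \<longleftrightarrow> (\<forall>c\<in>\<A>. chart_smooth c U h)"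
  unfolding smooth_fun_def chart_smooth_def ..

lemma smooth_vfield_iff: "smooth_vfield \<A> U V \<longleftrightarrow>
    (\<forall>p\<in>U. V p \<in> tangent_space \<A> p) \<and> (\<forall>c\<in>\<A>. chart_smooth c U (\<lambda>p. coord (V p) c))"
  unfolding smooth_vfield_def chart_smooth_def ..

text \<open>The set \<open>K\<close> is what makes extension by zero possible: it is the preimage of
  a closed Euclidean ball, hence compact, hence closed in the Hausdorff space and not merely in the
  chart domain.\<close>

lemma smooth_bump_on:
  assumes "open U" "p \<in> U"
  obtains \<beta> N K where "smooth_fun \<A> UNIV \<beta>" "open N" "p \<in> N" "N \<subseteq> U"
    "\<forall>q\<in>N. \<beta> q = (1::real)" "closed K" "K \<subseteq> U" "\<forall>q. q \<notin> K \<longrightarrow> \<beta> q = 0"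
proof -
  obtain c where c: "c \<in> \<A>" "p \<in> fst c" using chart_at by blast
  let ?a = "snd c p"
  let ?R = "snd c ` (fst c \<inter> U)"
  obtain e where e: "e > 0" "cball ?a e \<subseteq> ?R"
    using open_chart_image[OF c(1) assms(1)] c assms(2) open_contains_cball by blast
  define r where "r = e / 2"
  have r: "r > 0" "cball ?a (2 * r) \<subseteq> ?R" using e by (auto simp: r_def)
  obtain \<psi> :: "real ^ 'n \<Rightarrow> real" where \<psi>: "smooth_on UNIV \<psi>" "\<And>x. x \<in> ball ?a r \<Longrightarrow> \<psi> x = 1"
    "\<And>x. x \<notin> cball ?a (2 * r) \<Longrightarrow> \<psi> x = 0"
    using smooth_bump_exists[OF r(1)] by metis
  define \<beta> where "\<beta> q = (if q \<in> fst c then \<psi> (snd c q) else 0)" for q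
  define N where "N = fst c \<inter> snd c -` ball ?a r"
  define K where "K = chart_inv c ` cball ?a (2 * r)"
  have K_sub: "K \<subseteq> fst c \<inter> U"
  proof
    fix q assume "q \<in> K"
    then obtain x where x: "q = chart_inv c x" "x \<in> cball ?a (2 * r)" unfolding K_def by blast
    then obtain q' where "x = snd c q'" "q' \<in> fst c \<inter> U" using r(2) by blast
    then show "q \<in> fst c \<inter> U" using x(1) chart_inv_left[OF c(1)] by auto
  qed
  have "continuous_on (snd c ` fst c) (chart_inv c)"
    using chart_homeomorphism[OF c(1)] unfolding homeomorphism_def by blast
  then have "compact K"
    unfolding K_def using r(2) by (intro compact_continuous_image) (auto intro: continuous_on_subset)
  then have K: "closed K" by (rule compact_imp_closed)
  have out: "\<beta> q = 0" if "q \<notin> K" for q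
  proof (cases "q \<in> fst c")
    case True
    then have "snd c q \<notin> cball ?a (2 * r)"
      using that chart_inv_left[OF c(1) True] unfolding K_def by (metis imageI)
    then show ?thesis using \<psi>(3) by (simp add: \<beta>_def)
  qed (simp add: \<beta>_def)
  have "smooth_fun \<A> UNIV \<beta>"
    unfolding smooth_fun_iff
  proof (intro ballI chart_smooth_local)
    fix d q assume d: "d \<in> \<A>"
    show "\<exists>T. open T \<and> q \<in> T \<and> chart_smooth d T \<beta>"
    \<comment> \<open>The domain of \<open>c\<close> and the complement of \<open>K\<close> are open
      and cover the manifold; on the former \<open>\<beta>\<close> is a pulled-back Euclidean bump,
      on the latter it is 0.\<close>
    proof (cases "q \<in> fst c")
      case True
      have "chart_smooth d (fst c) \<beta>"
        by (rule chart_smooth_cong[OF d open_chart_dom[OF c(1)] _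
              chart_smooth_pullback[OF d c(1) smooth_on_subset[OF \<psi>(1) subset_UNIV]]])
          (simp add: \<beta>_def)
      then show ?thesis using True open_chart_dom[OF c(1)] by blast
    next
      case False
      have "chart_smooth d (- K) \<beta>"
        by (rule chart_smooth_cong[OF d open_Compl[OF K] _ chart_smooth_const]) (simp add: out)
      then show ?thesis using False K K_sub by (intro exI[of _ "- K"]) auto
    qed
  qed
  moreover have "open N" "p \<in> N"
    using open_chart_vimage[OF c(1) open_ball] c(2) r(1) by (auto simp: N_def)
  moreover have "N \<subseteq> U"
  proof
    fix q assume q: "q \<in> N"
    then have "snd c q \<in> cball ?a (2 * r)" using r(1) by (auto simp: N_def)
    then have "chart_inv c (snd c q) \<in> K" by (auto simp: K_def)
    then show "q \<in> U" using q K_sub chart_inv_left[OF c(1)] by (auto simp: N_def)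
  qed
  moreover have "\<beta> q = 1" if "q \<in> N" for q
    using that \<psi>(2) by (auto simp: \<beta>_def N_def)
  ultimately show ?thesis using that[of \<beta> N K] K K_sub out by blast
qed

text \<open>\<open>U\<close> and \<open>- K\<close> are open and cover the manifold. On
  \<open>- K\<close> the product is 0, whatever \<open>H\<close> does off \<open>U\<close>.\<close>

lemma chart_smooth_extend:
  assumes "c \<in> \<A>" "open U" "closed K" "K \<subseteq> U" "\<And>q. q \<notin> K \<Longrightarrow> \<beta> q = (0::real)"
    and "chart_smooth c UNIV \<beta>" "chart_smooth c U H"
  shows "chart_smooth c UNIV (\<lambda>q. \<beta> q *\<^sub>R H q)"
proof (rule chart_smooth_local[OF assms(1)])
  fix q
  show "\<exists>N. open N \<and> q \<in> N \<and> chart_smooth c N (\<lambda>q. \<beta> q *\<^sub>R H q)"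
  proof (cases "q \<in> U")
    case True
    have "chart_smooth c U (\<lambda>q. \<beta> q *\<^sub>R H q)"
      by (rule chart_smooth_bilinear[OF assms(1,2) bounded_bilinear_scaleR
            chart_smooth_subset[OF assms(6)] assms(7)]) simp
    then show ?thesis using True assms(2) by blast
  next
    case False
    have "chart_smooth c (- K) (\<lambda>q. \<beta> q *\<^sub>R H q)"
      by (rule chart_smooth_cong[OF assms(1) open_Compl[OF assms(3)] _ chart_smooth_const[where k = 0]])
        (simp add: assms(5))
    then show ?thesis using False assms(3,4) by (intro exI[of _ "- K"]) auto
  qed
qed

section \<open>Tangent spaces\<close>

lemma chart_smooth_has_derivative:
  assumes "c \<in> \<A>" "chart_smooth c U H" "p \<in> U" "p \<in> fst c"
  shows "((H \<circ> chart_inv c) has_derivative frechet_derivative (H \<circ> chart_inv c) (at (snd c p)))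
    (at (snd c p))"
  using assms unfolding chart_smooth_def by (intro smooth_on_has_derivative) auto

lemma transition_has_derivative:
  assumes "c \<in> \<A>" "c' \<in> \<A>" "p \<in> fst c" "p \<in> fst c'"
  shows "((snd c' \<circ> chart_inv c) has_derivative
    frechet_derivative (snd c' \<circ> chart_inv c) (at (snd c p))) (at (snd c p))"
  using assms by (intro smooth_on_has_derivative[OF transition_smooth]) auto

lemma linear_transition:
  assumes "c \<in> \<A>" "c' \<in> \<A>" "p \<in> fst c" "p \<in> fst c'"
  shows "linear (frechet_derivative (snd c' \<circ> chart_inv c) (at (snd c p)))"
  using transition_has_derivative[OF assms] has_derivative_linear by blast

text \<open>The chain rule applies to the composite of two transition maps. That composite agrees
  with the direct transition map on the image of \<open>fst c \<inter> fst c'\<close>, an open set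
  around the point, which determines the derivative.\<close>

lemma transition_derivative_trans:
  assumes "c \<in> \<A>" "c' \<in> \<A>" "c'' \<in> \<A>" "p \<in> fst c" "p \<in> fst c'" "p \<in> fst c''"
  shows "frechet_derivative (snd c'' \<circ> chart_inv c') (at (snd c' p))
      (frechet_derivative (snd c' \<circ> chart_inv c) (at (snd c p)) x)
    = frechet_derivative (snd c'' \<circ> chart_inv c) (at (snd c p)) x"
proof -
  have eq: "snd c' p = (snd c' \<circ> chart_inv c) (snd c p)"
    using assms by (simp add: chart_inv_left)
  have "((snd c'' \<circ> chart_inv c') \<circ> (snd c' \<circ> chart_inv c) has_derivative
      frechet_derivative (snd c'' \<circ> chart_inv c') (at (snd c' p)) \<circ>
      frechet_derivative (snd c' \<circ> chart_inv c) (at (snd c p))) (at (snd c p))"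
    using transition_has_derivative[OF assms(1,2,4,5)] transition_has_derivative[OF assms(2,3,5,6)]
    unfolding eq by (rule diff_chain_at)
  then have "((snd c'' \<circ> chart_inv c) has_derivative
      frechet_derivative (snd c'' \<circ> chart_inv c') (at (snd c' p)) \<circ>
      frechet_derivative (snd c' \<circ> chart_inv c) (at (snd c p))) (at (snd c p))"
    by (rule has_derivative_transform_within_open[OF _
          open_chart_image[OF assms(1) open_chart_dom[OF assms(2)]]])
      (use assms in \<open>auto simp: chart_inv_left\<close>)
  from frechet_derivative_at[OF this] show ?thesis by (metis comp_apply)
qed

lemma transition_derivative_refl:
  assumes "c \<in> \<A>" "p \<in> fst c"
  shows "frechet_derivative (snd c \<circ> chart_inv c) (at (snd c p)) x = x"
proof -
  have "((snd c \<circ> chart_inv c) has_derivative (\<lambda>x. x)) (at (snd c p))"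
    by (rule has_derivative_transform_within_open[OF has_derivative_ident open_chart_range[OF assms(1)]])
      (use assms in \<open>auto simp: chart_inv_left\<close>)
  from frechet_derivative_at[OF this] show ?thesis by metis
qed

text \<open>The type of tangent vectors is one large vector space for all points at once; each
  tangent space sits in it as a subspace, because the Jacobians are linear. This makes
  \<open>span\<close> and \<open>representation\<close> available for frames.\<close>

lemma subspace_tangent_space: "subspace (tangent_space \<A> p)"
proof (rule subspaceI)
  note lin = linear_transition
  show "0 \<in> tangent_space \<A> p"
    unfolding tangent_space_def by (simp add: linear_0[OF lin])
  fix v w :: "('a, 'n) tvec" and a :: real
  assume v: "v \<in> tangent_space \<A> p"
  show "a *\<^sub>R v \<in> tangent_space \<A> p"
    using v unfolding tangent_space_def mem_Collect_eq coord_simps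
    by (metis linear_scale[OF lin] scaleR_zero_right)
  assume w: "w \<in> tangent_space \<A> p"
  show "v + w \<in> tangent_space \<A> p"
    using v w unfolding tangent_space_def mem_Collect_eq coord_simps
    by (metis linear_add[OF lin] add.right_neutral)
qed

lemmas tangent_space_0 = subspace_0[OF subspace_tangent_space]
  and tangent_space_add = subspace_add[OF subspace_tangent_space]
  and tangent_space_diff = subspace_diff[OF subspace_tangent_space]
  and tangent_space_scale = subspace_scale[OF subspace_tangent_space]
  and tangent_space_sum = subspace_sum[OF subspace_tangent_space]

lemma coord_transition:
  "v \<in> tangent_space \<A> p \<Longrightarrow> c \<in> \<A> \<Longrightarrow> p \<in> fst c \<Longrightarrow> c' \<in> \<A> \<Longrightarrow> p \<in> fst c' \<Longrightarrow>
    coord v c' = frechet_derivative (snd c' \<circ> chart_inv c) (at (snd c p)) (coord v c)"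
  unfolding tangent_space_def by blast

text \<open>One chart around \<open>p\<close> determines a tangent vector: the coordinates in the
  other charts around \<open>p\<close> are linear images of these, and all remaining ones are 0 by
  convention.\<close>

lemma coord_eq_0D:
  assumes "v \<in> tangent_space \<A> p" "c \<in> \<A>" "p \<in> fst c" "coord v c = 0"
  shows "v = 0"
proof -
  have "coord v c' = 0" for c'
  proof (cases "c' \<in> \<A> \<and> p \<in> fst c'")
    case True
    then show ?thesis
      using coord_transition[OF assms(1-3)] linear_0[OF linear_transition] assms by auto
  next
    case False
    then show ?thesis using assms(1) unfolding tangent_space_def by blast
  qed
  then show ?thesis by (intro tvec.expand) (auto simp: zero_tvec_def)
qed

section \<open>The module of smooth vector fields over the smooth functions\<close>

lemma smooth_fun_subset: "smooth_fun \<A> T h \<Longrightarrow> S \<subseteq> T \<Longrightarrow> smooth_fun \<A> S h"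
  unfolding smooth_fun_iff by (blast intro: chart_smooth_subset[of _ T])

lemma smooth_fun_mult:
  "open U \<Longrightarrow> smooth_fun \<A> U h \<Longrightarrow> smooth_fun \<A> U k \<Longrightarrow> smooth_fun \<A> U (\<lambda>p. h p * k p)"
  unfolding smooth_fun_iff by (simp add: chart_smooth_bilinear[OF _ _ bounded_bilinear_mult])

lemma smooth_fun_const: "smooth_fun \<A> U (\<lambda>p. k)"
  unfolding smooth_fun_iff by (simp add: chart_smooth_const)

lemma smooth_fun_extend:
  assumes "open U" "closed K" "K \<subseteq> U" "\<And>q. q \<notin> K \<Longrightarrow> \<beta> q = (0::real)"
    and "smooth_fun \<A> UNIV \<beta>" "smooth_fun \<A> U h"
  shows "smooth_fun \<A> UNIV (\<lambda>q. \<beta> q * h q)"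
  unfolding smooth_fun_iff real_scaleR_def[symmetric]
proof
  show "chart_smooth c UNIV (\<lambda>q. \<beta> q *\<^sub>R h q)" if "c \<in> \<A>" for c
    by (rule chart_smooth_extend[OF that assms(1-3)])
      (use assms(4-6) that in \<open>auto simp: smooth_fun_iff\<close>)
qed

lemma smooth_vfieldD: "smooth_vfield \<A> U V \<Longrightarrow> p \<in> U \<Longrightarrow> V p \<in> tangent_space \<A> p"
  unfolding smooth_vfield_iff by blast

lemma smooth_vfield_subset: "smooth_vfield \<A> T V \<Longrightarrow> S \<subseteq> T \<Longrightarrow> smooth_vfield \<A> S V"
  unfolding smooth_vfield_iff by (blast intro: chart_smooth_subset[of _ T])

lemma smooth_vfield_local:
  assumes "\<And>p. p \<in> U \<Longrightarrow> \<exists>N. open N \<and> p \<in> N \<and> smooth_vfield \<A> N V"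
  shows "smooth_vfield \<A> U V"
  unfolding smooth_vfield_iff
proof (intro conjI ballI)
  show "V p \<in> tangent_space \<A> p" if "p \<in> U" for p
    using assms[OF that] smooth_vfieldD by blast
  show "chart_smooth c U (\<lambda>p. coord (V p) c)" if "c \<in> \<A>" for c
    using assms that unfolding smooth_vfield_iff by (intro chart_smooth_local[OF that]) blast
qed

lemma smooth_vfield_cong:
  assumes "open U" "\<And>p. p \<in> U \<Longrightarrow> V p = W p" "smooth_vfield \<A> U V"
  shows "smooth_vfield \<A> U W"
  unfolding smooth_vfield_iff
proof (intro conjI ballI)
  show "W p \<in> tangent_space \<A> p" if "p \<in> U" for p
    using smooth_vfieldD[OF assms(3) that] assms(2)[OF that] by simp
  show "chart_smooth c U (\<lambda>p. coord (W p) c)" if "c \<in> \<A>" for c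
    by (rule chart_smooth_cong[OF that assms(1), where H = "\<lambda>p. coord (V p) c"])
      (use assms(2,3) that in \<open>auto simp: smooth_vfield_iff\<close>)
qed

lemma smooth_vfield_0: "smooth_vfield \<A> U (\<lambda>p. 0)"
  unfolding smooth_vfield_iff by (auto simp: tangent_space_0 chart_smooth_const)

lemma smooth_vfield_scale:
  "open U \<Longrightarrow> smooth_fun \<A> U h \<Longrightarrow> smooth_vfield \<A> U V \<Longrightarrow> smooth_vfield \<A> U (\<lambda>p. h p *\<^sub>R V p)"
  unfolding smooth_vfield_iff smooth_fun_iff
  by (auto simp: tangent_space_scale intro: chart_smooth_bilinear[OF _ _ bounded_bilinear_scaleR])

lemma smooth_vfield_add:
  "open U \<Longrightarrow> smooth_vfield \<A> U V \<Longrightarrow> smooth_vfield \<A> U W \<Longrightarrow> smooth_vfield \<A> U (\<lambda>p. V p + W p)"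
  unfolding smooth_vfield_iff by (auto simp: tangent_space_add intro: chart_smooth_add)

lemma smooth_vfield_sum:
  "open U \<Longrightarrow> (\<And>i. i \<in> I \<Longrightarrow> smooth_vfield \<A> U (V i)) \<Longrightarrow> smooth_vfield \<A> U (\<lambda>p. \<Sum>i\<in>I. V i p)"
  unfolding smooth_vfield_iff by (auto intro!: tangent_space_sum chart_smooth_sum)

lemma smooth_vfield_extend:
  assumes "open U" "closed K" "K \<subseteq> U" "\<And>q. q \<notin> K \<Longrightarrow> \<beta> q = (0::real)"
    and "smooth_fun \<A> UNIV \<beta>" "smooth_vfield \<A> U V"
  shows "smooth_vfield \<A> UNIV (\<lambda>q. \<beta> q *\<^sub>R V q)"
proof -
  \<comment> \<open>Off \<open>U\<close> the value of \<open>V\<close> need not be tangent, but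
    there the factor is 0.\<close>
  have "\<beta> q *\<^sub>R V q \<in> tangent_space \<A> q" for q
    by (cases "q \<in> K") (use assms(3,4,6) in \<open>auto simp: tangent_space_0 tangent_space_scale smooth_vfieldD\<close>)
  moreover have "chart_smooth c UNIV (\<lambda>q. \<beta> q *\<^sub>R coord (V q) c)" if "c \<in> \<A>" for c
    by (rule chart_smooth_extend[OF that assms(1-3)])
      (use assms(4-6) that in \<open>auto simp: smooth_vfield_iff smooth_fun_iff\<close>)
  ultimately show ?thesis by (simp add: smooth_vfield_iff)
qed

section \<open>The differential\<close>

text \<open>Names the chart that \<open>differential\<close> picks at \<open>p\<close>, so that
  identities between differentials at \<open>p\<close> become identities between derivatives in this
  one chart.\<close>

definition some_chart :: "'a \<Rightarrow> ('a, 'n) chart" where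
  "some_chart p = (SOME c. c \<in> \<A> \<and> p \<in> fst c)"

lemma some_chart: "some_chart p \<in> \<A>" "p \<in> fst (some_chart p)"
proof -
  have "some_chart p \<in> \<A> \<and> p \<in> fst (some_chart p)"
    unfolding some_chart_def by (rule someI_ex) (use chart_at in blast)
  then show "some_chart p \<in> \<A>" "p \<in> fst (some_chart p)" by simp_all
qed

lemma differential_eq:
  "differential \<A> h p v
    = frechet_derivative (h \<circ> chart_inv (some_chart p)) (at (snd (some_chart p) p)) (coord v (some_chart p))"
  unfolding differential_def some_chart_def Let_def ..

lemma differential_eqI:
  assumes "((h \<circ> chart_inv (some_chart p)) has_derivative h') (at (snd (some_chart p) p))"
  shows "differential \<A> h p v = h' (coord v (some_chart p))"
  unfolding differential_eq frechet_derivative_at[OF assms, symmetric] ..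

lemma has_derivative_some_chart:
  assumes "p \<in> U" "\<And>c. c \<in> \<A> \<Longrightarrow> chart_smooth c U H"
  shows "((H \<circ> chart_inv (some_chart p)) has_derivative
    frechet_derivative (H \<circ> chart_inv (some_chart p)) (at (snd (some_chart p) p)))
    (at (snd (some_chart p) p))"
  using chart_smooth_has_derivative[OF some_chart(1) assms(2)[OF some_chart(1)] assms(1) some_chart(2)] .

lemma differential_cong:
  assumes "open N" "p \<in> N" "\<And>q. q \<in> N \<Longrightarrow> h q = k q" "\<And>c. c \<in> \<A> \<Longrightarrow> chart_smooth c N h"
  shows "differential \<A> k p v = differential \<A> h p v"
proof -
  have "((k \<circ> chart_inv (some_chart p)) has_derivative
      frechet_derivative (h \<circ> chart_inv (some_chart p)) (at (snd (some_chart p) p)))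
      (at (snd (some_chart p) p))"
    by (rule has_derivative_transform_within_open[OF
          has_derivative_some_chart[OF assms(2,4)] open_chart_image[OF some_chart(1) assms(1)]])
      (use assms(2,3) some_chart in \<open>auto simp: chart_inv_left\<close>)
  from differential_eqI[OF this] show ?thesis unfolding differential_eq[of h] .
qed

text \<open>Applied to component projections, this splits the differential of a vector- or
  matrix-valued map into the differentials of its entries.\<close>

lemma differential_bounded_linear:
  assumes "bounded_linear b" "p \<in> U" "\<And>c. c \<in> \<A> \<Longrightarrow> chart_smooth c U H"
  shows "differential \<A> (\<lambda>q. b (H q)) p v = b (differential \<A> H p v)"
proof -
  have "((\<lambda>q. b (H q)) \<circ> chart_inv (some_chart p) has_derivative
      (\<lambda>x. b (frechet_derivative (H \<circ> chart_inv (some_chart p)) (at (snd (some_chart p) p)) x)))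
      (at (snd (some_chart p) p))"
    using bounded_linear.has_derivative[OF assms(1) has_derivative_some_chart[OF assms(2,3)]]
    unfolding comp_def .
  from differential_eqI[OF this] show ?thesis unfolding differential_eq[of H] .
qed

text \<open>The map is the sum of its components placed on the axes by bounded linear maps. The
  entries may lie in any normed space, so a second application covers matrices, which are vectors of
  rows.\<close>

lemma chart_smooth_vec:
  fixes H :: "'a \<Rightarrow> 'b::real_normed_vector ^ 'm"
  assumes "c \<in> \<A>" "open U" "\<And>i. chart_smooth c U (\<lambda>p. H p $ i)"
  shows "chart_smooth c U H"
proof -
  have lin: "bounded_linear (axis i :: 'b \<Rightarrow> 'b ^ 'm)" for i
  proof (rule bounded_linear_intro[where K = 1])
    \<comment> \<open>The norm of a vector is at most the sum of the norms of its entries, and here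
      only one entry can be nonzero; this gives the bound 1.\<close>
    have "(\<Sum>j\<in>UNIV. norm ((axis i x :: 'b ^ 'm) $ j)) = (\<Sum>j\<in>UNIV. if j = i then norm x else 0)" for x
      by (rule sum.cong) (auto simp: axis_def)
    then have sum_eq: "(\<Sum>j\<in>UNIV. norm ((axis i x :: 'b ^ 'm) $ j)) = norm x" for x by simp
    show "norm (axis i x :: 'b ^ 'm) \<le> norm x * 1" for x
      using L2_set_le_sum[of UNIV "\<lambda>j. norm ((axis i x :: 'b ^ 'm) $ j)"] sum_eq[of x]
      by (simp only: norm_vec_def mult_1_right norm_ge_zero)
  qed (auto simp: axis_def vec_eq_iff)
  have "H p = (\<Sum>i\<in>UNIV. axis i (H p $ i))" for p
    by (auto simp: vec_eq_iff axis_def cong: if_cong)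
  then have eq: "H = (\<lambda>p. \<Sum>i\<in>UNIV. axis i (H p $ i))" by (rule ext)
  show ?thesis
    by (subst eq) (intro chart_smooth_sum chart_smooth_bounded_linear[OF assms(1,2) lin] assms)
qed

end

section \<open>Frames\<close>

lemma det_nz_if_inj:
  fixes A :: "real ^ 'm ^ 'm"
  assumes "\<And>x. A *v x = 0 \<Longrightarrow> x = 0"
  shows "det A \<noteq> 0"
proof -
  have "\<exists>B. B ** A = mat 1" unfolding matrix_left_invertible_ker using assms by blast
  then show ?thesis
    unfolding invertible_det_nz[symmetric] using invertible_left_inverse by blast
qed

lemma matrix_inv_left:
  fixes M :: "'b::semiring_1 ^ 'm ^ 'm"
  assumes "invertible M"
  shows "matrix_inv M ** M = mat 1"
proof -
  have "M ** matrix_inv M = mat 1 \<and> matrix_inv M ** M = mat 1"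
    unfolding matrix_inv_def by (rule someI_ex) (use assms in \<open>simp add: invertible_def\<close>)
  then show ?thesis by simp
qed

context smooth_manifold
begin

text \<open>\<open>independent\<close> and \<open>span\<close> see only the set of values of
  \<open>b\<close>, in which repeated vectors collapse. The lemma passes from linear algebra of
  indexed families to sets, with injectivity as part of the conclusion.\<close>

lemma frame_atI:
  fixes b :: "'n \<Rightarrow> ('a, 'n) tvec"
  assumes "\<And>i. b i \<in> tangent_space \<A> p"
    and gen: "\<And>v. v \<in> tangent_space \<A> p \<Longrightarrow> \<exists>a. v = (\<Sum>i\<in>UNIV. a i *\<^sub>R b i)"
    and indep: "\<And>a i. (\<Sum>i\<in>UNIV. a i *\<^sub>R b i) = 0 \<Longrightarrow> a i = (0::real)"
  shows "inj b \<and> independent (range b) \<and> span (range b) = tangent_space \<A> p"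
proof (intro conjI)
  show inj: "inj b"
  proof (rule injI, rule ccontr)
    fix i j assume ij: "b i = b j" "i \<noteq> j"
    \<comment> \<open>If \<open>b i = b j\<close>, these coefficients give a vanishing combination
      although \<open>a i = 1\<close>.\<close>
    define a :: "'n \<Rightarrow> real" where "a k = (if k = i then 1 else 0) - (if k = j then 1 else 0)" for k
    have "(\<Sum>k\<in>UNIV. a k *\<^sub>R b k) = b i - b j"
      by (simp add: a_def scaleR_diff_left sum_subtractf if_distrib[of "\<lambda>x. x *\<^sub>R _"] cong: if_cong)
    then have "a i = 0" using indep[of a i] ij(1) by simp
    then show False using ij(2) by (simp add: a_def)
  qed
  show "independent (range b)"
    unfolding dependent_finite[OF finite_imageI[OF finite_class.finite_UNIV]]
  proof
    assume "\<exists>u. (\<exists>v\<in>range b. u v \<noteq> 0) \<and> (\<Sum>v\<in>range b. u v *\<^sub>R v) = 0"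
    then obtain u i where "u (b i) \<noteq> 0" "(\<Sum>v\<in>range b. u v *\<^sub>R v) = 0" by blast
    then show False using indep[of "\<lambda>i. u (b i)" i] sum.reindex[OF inj, of "\<lambda>v. u v *\<^sub>R v"]
      by (simp add: comp_def)
  qed
  show "span (range b) = tangent_space \<A> p"
  proof
    show "span (range b) \<subseteq> tangent_space \<A> p"
      using assms(1) by (intro span_minimal subspace_tangent_space) auto
    show "tangent_space \<A> p \<subseteq> span (range b)"
    proof
      fix v assume "v \<in> tangent_space \<A> p"
      then obtain a where a: "v = (\<Sum>i\<in>UNIV. a i *\<^sub>R b i)" using gen by blast
      show "v \<in> span (range b)"
        unfolding a by (intro span_sum span_scale) (simp add: span_base)
    qed
  qed
qed

section \<open>Components with respect to a local frame\<close>

lemma local_frameD: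
  assumes "local_frame \<A> U e" "p \<in> U"
  shows "inj (\<lambda>i. e i p)" "independent (range (\<lambda>i. e i p))"
    "span (range (\<lambda>i. e i p)) = tangent_space \<A> p"
  using assms unfolding local_frame_def by simp_all

lemma local_frame_smooth: "local_frame \<A> U e \<Longrightarrow> smooth_vfield \<A> U (e i)"
  unfolding local_frame_def by simp

lemma local_frame_subset: "local_frame \<A> T e \<Longrightarrow> S \<subseteq> T \<Longrightarrow> local_frame \<A> S e"
  unfolding local_frame_def using smooth_vfield_subset[of T _ S] by (meson subsetD)

lemma frame_sum:
  assumes "local_frame \<A> U e" "p \<in> U" "v \<in> tangent_space \<A> p"
  shows "(\<Sum>i\<in>UNIV. frame_coords e p v $ i *\<^sub>R e i p) = v"
proof -
  note fr = local_frameD[OF assms(1,2)]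
  let ?B = "range (\<lambda>i. e i p)"
  have "(\<Sum>b\<in>?B. representation ?B v b *\<^sub>R b) = v"
    using fr assms(3) by (intro real_vector.sum_representation_eq) auto
  then show ?thesis unfolding sum.reindex[OF fr(1)] by (simp add: frame_coords_def)
qed

lemma frame_coords_add:
  assumes "local_frame \<A> U e" "p \<in> U" "v \<in> tangent_space \<A> p" "w \<in> tangent_space \<A> p"
  shows "frame_coords e p (v + w) = frame_coords e p v + frame_coords e p w"
  using local_frameD[OF assms(1,2)] assms(3,4)
  by (simp add: frame_coords_def vec_eq_iff real_vector.representation_add)

lemma frame_coords_scale:
  assumes "local_frame \<A> U e" "p \<in> U" "v \<in> tangent_space \<A> p"
  shows "frame_coords e p (a *\<^sub>R v) = a *\<^sub>R frame_coords e p v"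
  using local_frameD[OF assms(1,2)] assms(3)
  by (simp add: frame_coords_def vec_eq_iff real_vector.representation_scale)

lemma frame_coords_0: "frame_coords e p 0 = 0"
  by (simp add: frame_coords_def vec_eq_iff real_vector.representation_zero)

lemma frame_coords_sum:
  assumes "local_frame \<A> U e" "p \<in> U" "\<And>i. i \<in> I \<Longrightarrow> v i \<in> tangent_space \<A> p"
  shows "frame_coords e p (\<Sum>i\<in>I. v i) = (\<Sum>i\<in>I. frame_coords e p (v i))"
  using assms(3)
  by (induction I rule: infinite_finite_induct)
    (simp_all add: frame_coords_0 frame_coords_add[OF assms(1,2)] tangent_space_sum)

lemma frame_coords_basis:
  assumes "local_frame \<A> U e" "p \<in> U"
  shows "frame_coords e p (e i p) = axis i 1"
proof -
  note fr = local_frameD[OF assms]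
  have "representation (range (\<lambda>j. e j p)) (e i p) = (\<lambda>v. if v = e i p then 1 else 0)"
    by (rule real_vector.representation_basis[OF fr(2)]) simp
  then show ?thesis using inj_eq[OF fr(1)] by (auto simp: frame_coords_def axis_def vec_eq_iff)
qed

lemma frame_coords_of_sum:
  assumes "local_frame \<A> U e" "p \<in> U"
  shows "frame_coords e p (\<Sum>i\<in>UNIV. a i *\<^sub>R e i p) = (\<chi> i. a i)"
proof -
  have e: "e i p \<in> tangent_space \<A> p" for i
    using smooth_vfieldD[OF local_frame_smooth[OF assms(1)] assms(2)] .
  have "frame_coords e p (\<Sum>i\<in>UNIV. a i *\<^sub>R e i p) = (\<Sum>i\<in>UNIV. a i *\<^sub>R axis i 1)"
    by (simp add: frame_coords_sum[OF assms] frame_coords_scale[OF assms] e tangent_space_scale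
        frame_coords_basis[OF assms])
  also have "\<dots> = (\<chi> i. a i)"
    by (simp add: vec_eq_iff axis_def if_distrib[of "\<lambda>x. _ * x"] cong: if_cong)
  finally show ?thesis .
qed

lemma frame_coords_eq_0_iff:
  assumes "local_frame \<A> U e" "p \<in> U" "v \<in> tangent_space \<A> p"
  shows "frame_coords e p v = 0 \<longleftrightarrow> v = 0"
  using frame_sum[OF assms] by (auto simp: frame_coords_0)

text \<open>The frame components solve a linear system whose matrix holds the chart coordinates of the
  frame, so Cramer's rule makes them smooth.\<close>

lemma frame_coords_smooth:
  assumes "open U" "local_frame \<A> U e" "smooth_vfield \<A> U V"
  shows "smooth_fun \<A> U (\<lambda>q. frame_coords e q (V q) $ k)"
  unfolding smooth_fun_iff
proof
  fix c assume c: "c \<in> \<A>"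
  define E where "E q = (\<chi> i j. coord (e j q) c $ i)" for q
  define F where "F q = (\<chi> i j. if j = k then coord (V q) c $ i else E q $ i $ j)" for q
  have Ev: "E q *v x = coord (\<Sum>j\<in>UNIV. x $ j *\<^sub>R e j q) c" for q x
    by (simp add: E_def matrix_vector_mult_def vec_eq_iff mult.commute)
  \<comment> \<open>A kernel vector gives a combination of the frame whose coordinates in
    \<open>c\<close> vanish. Such a tangent vector is 0, so its frame components vanish too.\<close>
  have det_E: "det (E q) \<noteq> 0" if q: "q \<in> U" "q \<in> fst c" for q
  proof (rule det_nz_if_inj)
    fix x assume "E q *v x = 0"
    moreover have "(\<Sum>j\<in>UNIV. x $ j *\<^sub>R e j q) \<in> tangent_space \<A> q"
      using smooth_vfieldD[OF local_frame_smooth[OF assms(2)] q(1)]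
      by (intro tangent_space_sum tangent_space_scale)
    ultimately have "(\<Sum>j\<in>UNIV. x $ j *\<^sub>R e j q) = 0"
      unfolding Ev using coord_eq_0D[OF _ c q(2)] by blast
    then show "x = 0"
      using frame_coords_of_sum[OF assms(2) q(1), of "\<lambda>j. x $ j"] by (simp add: frame_coords_0)
  qed
  have smooth_e: "chart_smooth c U (\<lambda>q. coord (e j q) c $ i)" for i j
    by (rule chart_smooth_bounded_linear[OF c assms(1) bounded_linear_vec_nth])
      (use local_frame_smooth[OF assms(2)] c in \<open>simp add: smooth_vfield_iff\<close>)
  have smooth_V: "chart_smooth c U (\<lambda>q. coord (V q) c $ i)" for i
    by (rule chart_smooth_bounded_linear[OF c assms(1) bounded_linear_vec_nth])
      (use assms(3) c in \<open>simp add: smooth_vfield_iff\<close>)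
  have "chart_smooth c U (\<lambda>q. det (E q))"
    by (rule chart_smooth_det[OF c assms(1)]) (simp add: E_def smooth_e)
  then have "chart_smooth c U (\<lambda>q. inverse (det (E q)))"
    by (rule chart_smooth_inverse[OF c assms(1)]) (rule det_E)
  moreover have "chart_smooth c U (\<lambda>q. det (F q))"
  proof (rule chart_smooth_det[OF c assms(1)])
    show "chart_smooth c U (\<lambda>q. F q $ i $ j)" for i j
      by (cases "j = k") (simp_all add: F_def E_def smooth_e smooth_V)
  qed
  ultimately have "chart_smooth c U (\<lambda>q. inverse (det (E q)) * det (F q))"
    by (rule chart_smooth_bilinear[OF c assms(1) bounded_bilinear_mult])
  then show "chart_smooth c U (\<lambda>q. frame_coords e q (V q) $ k)"
  proof (rule chart_smooth_cong[OF c assms(1), rotated])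
    fix q assume q: "q \<in> U" "q \<in> fst c"
    have Eq: "E q *v frame_coords e q (V q) = coord (V q) c"
      unfolding Ev frame_sum[OF assms(2) q(1) smooth_vfieldD[OF assms(3) q(1)]] ..
    have "det (F q) = frame_coords e q (V q) $ k * det (E q)"
      using cramer_lemma[where A = "E q" and x = "frame_coords e q (V q)" and k = k]
      unfolding Eq F_def .
    then show "inverse (det (E q)) * det (F q) = frame_coords e q (V q) $ k"
      using det_E[OF q] by simp
  qed
qed

lemma coordinate_frame_exists:
  assumes c: "c \<in> \<A>"
  shows "\<exists>e. local_frame \<A> (fst c) e"
proof -
  \<comment> \<open>These are the coordinate fields of \<open>c\<close>: constant basis vectors in
    \<open>c\<close> itself, transported to the other charts by the Jacobians, and 0 where
    \<open>tangent_space\<close> demands it.\<close>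
  define e :: "'n \<Rightarrow> ('a, 'n) vfield" where "e i q = Tvec (\<lambda>c'. if c' \<in> \<A> \<and> q \<in> fst c'
    then frechet_derivative (snd c' \<circ> chart_inv c) (at (snd c q)) (axis i 1) else 0)" for i q
  have e_in: "e i q \<in> tangent_space \<A> q" if q: "q \<in> fst c" for i q
    unfolding tangent_space_def
    by (auto simp: e_def transition_derivative_trans[OF c _ _ q])
  have e_c: "coord (e i q) c = axis i 1" if q: "q \<in> fst c" for i q
    using c q by (simp add: e_def transition_derivative_refl)
  have sum_c: "coord (\<Sum>i\<in>UNIV. a i *\<^sub>R e i q) c = (\<chi> i. a i)" if q: "q \<in> fst c" for a q
    by (simp add: e_c[OF q] vec_eq_iff axis_def if_distrib[of "\<lambda>x. _ * x"] cong: if_cong)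
  have "smooth_vfield \<A> (fst c) (e i)" for i
    unfolding smooth_vfield_iff
  proof (intro conjI ballI e_in)
    fix c' assume c': "c' \<in> \<A>"
    let ?F = "\<lambda>y. frechet_derivative (snd c' \<circ> chart_inv c) (at y) (axis i 1)"
    let ?W = "fst c \<inter> fst c'"
    have W: "open ?W" using open_chart_dom c c' by blast
    \<comment> \<open>The Jacobian column \<open>?F\<close> is smooth in the coordinates of
      \<open>c\<close>, but smoothness has to be shown in those of \<open>c'\<close>; hence the
      composition with the transition map back to \<open>c\<close>.\<close>
    have "smooth_on (snd c' ` ?W) (\<lambda>x. ?F ((snd c \<circ> chart_inv c') x))"
    proof (rule smooth_on_compose[where T = "snd c ` ?W" and g = ?F])
      show "open (snd c' ` ?W)"
        using open_chart_image[OF c' open_chart_dom[OF c]] by (simp add: Int_commute)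
      show "smooth_on (snd c ` ?W) ?F"
        by (rule smooth_on_frechet_derivative[OF transition_smooth[OF c c']])
      show "smooth_on (snd c' ` ?W) (snd c \<circ> chart_inv c')"
        using transition_smooth[OF c' c] by (simp add: Int_commute)
      show "(snd c \<circ> chart_inv c') ` snd c' ` ?W \<subseteq> snd c ` ?W"
        using c' by (auto simp: chart_inv_left)
    qed
    then have "chart_smooth c' (fst c) (\<lambda>q. ?F (snd c q))"
      by (simp add: chart_smooth_def comp_def Int_commute)
    then show "chart_smooth c' (fst c) (\<lambda>q. coord (e i q) c')"
      by (rule chart_smooth_cong[OF c' open_chart_dom[OF c], rotated]) (simp add: e_def c')
  qed
  moreover have "inj (\<lambda>i. e i q) \<and> independent (range (\<lambda>i. e i q)) \<and>
      span (range (\<lambda>i. e i q)) = tangent_space \<A> q" if q: "q \<in> fst c" for q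
  proof (rule frame_atI)
    show "e i q \<in> tangent_space \<A> q" for i by (rule e_in[OF q])
    show "a i = 0" if "(\<Sum>i\<in>UNIV. a i *\<^sub>R e i q) = 0" for a i
      using sum_c[OF q, of a] that by (simp add: vec_eq_iff)
    fix v assume v: "v \<in> tangent_space \<A> q"
    let ?w = "\<Sum>i\<in>UNIV. coord v c $ i *\<^sub>R e i q"
    have "v - ?w \<in> tangent_space \<A> q"
      by (intro tangent_space_diff tangent_space_sum tangent_space_scale v e_in q)
    moreover have "coord (v - ?w) c = 0"
      unfolding coord_simps(4) sum_c[OF q, of "\<lambda>i. coord v c $ i"] by simp
    ultimately have "v - ?w = 0" by (rule coord_eq_0D[OF _ c q])
    then show "\<exists>a. v = (\<Sum>i\<in>UNIV. a i *\<^sub>R e i q)"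
      by (intro exI[of _ "\<lambda>i. coord v c $ i"]) simp
  qed
  ultimately show ?thesis unfolding local_frame_def by blast
qed

lemma local_frame_at:
  obtains W e where "open W" "p \<in> W" "local_frame \<A> W e"
proof -
  obtain c where c: "c \<in> \<A>" "p \<in> fst c" using chart_at by blast
  obtain e where "local_frame \<A> (fst c) e" using coordinate_frame_exists[OF c(1)] by blast
  then show ?thesis using that[OF open_chart_dom[OF c(1)] c(2)] by simp
qed

section \<open>Deformation fields\<close>

lemma deformation_linear:
  assumes "deformation_field \<A> P" "v \<in> tangent_space \<A> p" "w \<in> tangent_space \<A> p"
  shows "P p (a *\<^sub>R v + b *\<^sub>R w) = a *\<^sub>R P p v + b *\<^sub>R P p w"
  using assms unfolding deformation_field_def by simp

lemma deformation_add:
  assumes "deformation_field \<A> P" "v \<in> tangent_space \<A> p" "w \<in> tangent_space \<A> p"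
  shows "P p (v + w) = P p v + P p w"
  using deformation_linear[OF assms, of 1 1] by simp

lemma deformation_scale:
  assumes "deformation_field \<A> P" "v \<in> tangent_space \<A> p"
  shows "P p (a *\<^sub>R v) = a *\<^sub>R P p v"
  using deformation_linear[OF assms assms(2), of a 0] by simp

lemma deformation_0:
  assumes "deformation_field \<A> P"
  shows "P p 0 = 0"
  using deformation_scale[OF assms tangent_space_0, of p 0] by simp

lemma deformation_bij:
  "deformation_field \<A> P \<Longrightarrow> bij_betw (P p) (tangent_space \<A> p) (tangent_space \<A> p)"
  unfolding deformation_field_def by simp

lemma deformation_in:
  "deformation_field \<A> P \<Longrightarrow> v \<in> tangent_space \<A> p \<Longrightarrow> P p v \<in> tangent_space \<A> p"
  by (rule bij_betw_apply[OF deformation_bij])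

lemma deformation_sum:
  assumes "deformation_field \<A> P" "\<And>i. i \<in> I \<Longrightarrow> v i \<in> tangent_space \<A> p"
  shows "P p (\<Sum>i\<in>I. v i) = (\<Sum>i\<in>I. P p (v i))"
  using assms(2)
  by (induction I rule: infinite_finite_induct)
    (simp_all add: deformation_0[OF assms(1)] deformation_add[OF assms(1)] tangent_space_sum)

lemma deformation_eq_0D:
  assumes "deformation_field \<A> P" "v \<in> tangent_space \<A> p" "P p v = 0"
  shows "v = 0"
  using bij_betw_imp_inj_on[OF deformation_bij[OF assms(1)]] assms(2,3) tangent_space_0
    deformation_0[OF assms(1), of p] by (metis inj_onD)

lemma deformation_smooth:
  "deformation_field \<A> P \<Longrightarrow> open U \<Longrightarrow> smooth_vfield \<A> U V \<Longrightarrow> smooth_vfield \<A> U (reference_rep P V)"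
  unfolding deformation_field_def reference_rep_def by simp

section \<open>The inverse deformation\<close>

abbreviation deformation_inv :: "('a, 'n) endo_field \<Rightarrow> ('a, 'n) endo_field" where
  "deformation_inv P p \<equiv> inv_into (tangent_space \<A> p) (P p)"

lemma deformation_inv_right:
  "deformation_field \<A> P \<Longrightarrow> v \<in> tangent_space \<A> p \<Longrightarrow> P p (deformation_inv P p v) = v"
  using bij_betw_inv_into_right[OF deformation_bij] .

lemma deformation_inv_left:
  "deformation_field \<A> P \<Longrightarrow> v \<in> tangent_space \<A> p \<Longrightarrow> deformation_inv P p (P p v) = v"
  using bij_betw_inv_into_left[OF deformation_bij] .

lemma deformation_inv_in:
  "deformation_field \<A> P \<Longrightarrow> v \<in> tangent_space \<A> p \<Longrightarrow> deformation_inv P p v \<in> tangent_space \<A> p"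
  using bij_betw_apply[OF bij_betw_inv_into[OF deformation_bij]] .

lemma deformation_inv_linear:
  assumes P: "deformation_field \<A> P" and v: "v \<in> tangent_space \<A> p" and w: "w \<in> tangent_space \<A> p"
  shows "deformation_inv P p (a *\<^sub>R v + b *\<^sub>R w) = a *\<^sub>R deformation_inv P p v + b *\<^sub>R deformation_inv P p w"
proof -
  let ?v = "deformation_inv P p v" and ?w = "deformation_inv P p w"
  have in_T: "?v \<in> tangent_space \<A> p" "?w \<in> tangent_space \<A> p"
    using deformation_inv_in[OF P] v w by simp_all
  have "P p (a *\<^sub>R ?v + b *\<^sub>R ?w) = a *\<^sub>R v + b *\<^sub>R w"
    by (simp add: deformation_linear[OF P in_T] deformation_inv_right[OF P] v w)
  moreover have "a *\<^sub>R ?v + b *\<^sub>R ?w \<in> tangent_space \<A> p"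
    by (intro tangent_space_add tangent_space_scale in_T)
  ultimately show ?thesis using deformation_inv_left[OF P] by metis
qed

lemma deformation_frame:
  assumes P: "deformation_field \<A> P" and "open U" and e: "local_frame \<A> U e"
  shows "local_frame \<A> U (\<lambda>i. reference_rep P (e i))"
  unfolding local_frame_def
proof (intro conjI allI ballI)
  show "smooth_vfield \<A> U (reference_rep P (e i))" for i
    by (rule deformation_smooth[OF P assms(2) local_frame_smooth[OF e]])
next
  fix p assume p: "p \<in> U"
  let ?b = "\<lambda>i. reference_rep P (e i) p"
  have e_in: "e i p \<in> tangent_space \<A> p" for i
    using smooth_vfieldD[OF local_frame_smooth[OF e] p] .
  have sum: "(\<Sum>i\<in>UNIV. a i *\<^sub>R ?b i) = P p (\<Sum>i\<in>UNIV. a i *\<^sub>R e i p)" for a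
    by (simp add: reference_rep_def deformation_sum[OF P] tangent_space_scale e_in
        deformation_scale[OF P])
  have "inj ?b \<and> independent (range ?b) \<and> span (range ?b) = tangent_space \<A> p"
  proof (rule frame_atI)
    show "?b i \<in> tangent_space \<A> p" for i
      unfolding reference_rep_def by (rule deformation_in[OF P e_in])
    show "a i = 0" if "(\<Sum>i\<in>UNIV. a i *\<^sub>R ?b i) = 0" for a i
    proof -
      have "(\<Sum>i\<in>UNIV. a i *\<^sub>R e i p) = 0"
        by (rule deformation_eq_0D[OF P _ that[unfolded sum]])
          (intro tangent_space_sum tangent_space_scale e_in)
      then show ?thesis
        using frame_coords_of_sum[OF e p, of a] by (simp add: frame_coords_0 vec_eq_iff)
    qed
    fix v assume v: "v \<in> tangent_space \<A> p"
    have "P p (\<Sum>i\<in>UNIV. frame_coords e p (deformation_inv P p v) $ i *\<^sub>R e i p) = v"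
      unfolding frame_sum[OF e p deformation_inv_in[OF P v]] by (rule deformation_inv_right[OF P v])
    then have "v = (\<Sum>i\<in>UNIV. frame_coords e p (deformation_inv P p v) $ i *\<^sub>R ?b i)"
      unfolding sum by (rule sym)
    then show "\<exists>a. v = (\<Sum>i\<in>UNIV. a i *\<^sub>R ?b i)"
      by (rule exI[of _ "\<lambda>i. frame_coords e p (deformation_inv P p v) $ i"])
  qed
  then show "inj ?b" "independent (range ?b)" "span (range ?b) = tangent_space \<A> p" by simp_all
qed

lemma deformation_inv_smooth:
  assumes P: "deformation_field \<A> P" and "open U" and V: "smooth_vfield \<A> U V"
  shows "smooth_vfield \<A> U (\<lambda>p. deformation_inv P p (V p))"
proof (rule smooth_vfield_local)
  fix p assume "p \<in> U"
  \<comment> \<open>Smoothness may be tested near each point, so a frame around \<open>p\<close> is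
    enough; there may be none on all of \<open>U\<close>.\<close>
  obtain W e where W: "open W" "p \<in> W" "local_frame \<A> W e" by (rule local_frame_at)
  define N where "N = U \<inter> W"
  define f where "f i = reference_rep P (e i)" for i
  have N: "open N" "p \<in> N" using W \<open>p \<in> U\<close> assms(2) by (auto simp: N_def)
  have e: "local_frame \<A> N e" using local_frame_subset[OF W(3)] by (simp add: N_def)
  have f: "local_frame \<A> N f" unfolding f_def by (rule deformation_frame[OF P N(1) e])
  have VN: "smooth_vfield \<A> N V" by (rule smooth_vfield_subset[OF V]) (simp add: N_def)
  let ?a = "\<lambda>i q. frame_coords f q (V q) $ i"
  have "smooth_vfield \<A> N (\<lambda>q. \<Sum>i\<in>UNIV. ?a i q *\<^sub>R e i q)"
    by (intro smooth_vfield_sum smooth_vfield_scale N frame_coords_smooth f VN local_frame_smooth[OF e])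
  moreover have "(\<Sum>i\<in>UNIV. ?a i q *\<^sub>R e i q) = deformation_inv P q (V q)" if q: "q \<in> N" for q
  proof -
    have e_in: "e i q \<in> tangent_space \<A> q" for i
      using smooth_vfieldD[OF local_frame_smooth[OF e] q] .
    have "P q (\<Sum>i\<in>UNIV. ?a i q *\<^sub>R e i q) = (\<Sum>i\<in>UNIV. ?a i q *\<^sub>R f i q)"
      by (simp add: f_def reference_rep_def deformation_sum[OF P] tangent_space_scale e_in
          deformation_scale[OF P])
    also have "\<dots> = V q" by (rule frame_sum[OF f q smooth_vfieldD[OF VN q]])
    finally have eq: "P q (\<Sum>i\<in>UNIV. ?a i q *\<^sub>R e i q) = V q" .
    have "(\<Sum>i\<in>UNIV. ?a i q *\<^sub>R e i q) \<in> tangent_space \<A> q"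
      by (intro tangent_space_sum tangent_space_scale e_in)
    from deformation_inv_left[OF P this] show ?thesis unfolding eq by (rule sym)
  qed
  ultimately have "smooth_vfield \<A> N (\<lambda>p. deformation_inv P p (V p))"
    by (rule smooth_vfield_cong[OF N(1), rotated])
  then show "\<exists>N. open N \<and> p \<in> N \<and> smooth_vfield \<A> N (\<lambda>p. deformation_inv P p (V p))"
    using N by blast
qed

section \<open>Affine connections\<close>

text \<open>A field on \<open>U\<close> may have no smooth extension across the boundary of
  \<open>U\<close>, so agreement is obtained near \<open>p\<close> only. This is exactly what
  \<open>local_covd\<close> asks for.\<close>

lemma vfield_extension:
  assumes "open U" "p \<in> U" "smooth_vfield \<A> U V"
  obtains W N where "smooth_vfield \<A> UNIV W" "open N" "p \<in> N" "\<forall>q\<in>N. W q = V q"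
proof -
  obtain \<beta> N K where "smooth_fun \<A> UNIV \<beta>" "open N" "p \<in> N" "N \<subseteq> U"
    "\<forall>q\<in>N. \<beta> q = (1::real)" "closed K" "K \<subseteq> U" "\<forall>q. q \<notin> K \<longrightarrow> \<beta> q = 0"
    by (rule smooth_bump_on[OF assms(1,2)])
  note \<beta> = this(1-4) this(5)[rule_format] this(6,7) this(8)[rule_format]
  have "smooth_vfield \<A> UNIV (\<lambda>q. \<beta> q *\<^sub>R V q)"
    by (rule smooth_vfield_extend[OF assms(1) \<beta>(6-8) \<beta>(1) assms(3)])
  then show ?thesis by (rule that[OF _ \<beta>(2,3)]) (simp add: \<beta>(5))
qed

lemma tangent_extension:
  assumes "v \<in> tangent_space \<A> p"
  obtains X where "smooth_vfield \<A> UNIV X" "X p = v"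
proof -
  obtain U e where U: "open U" "p \<in> U" "local_frame \<A> U e" by (rule local_frame_at)
  \<comment> \<open>The field with the components of \<open>v\<close> at \<open>p\<close>, held
    constant over the domain of the frame.\<close>
  let ?V = "\<lambda>q. \<Sum>i\<in>UNIV. frame_coords e p v $ i *\<^sub>R e i q"
  have "smooth_vfield \<A> U ?V"
    by (intro smooth_vfield_sum smooth_vfield_scale smooth_fun_const U local_frame_smooth)
  then obtain W N where
    "smooth_vfield \<A> UNIV W" "open N" "p \<in> N" "\<forall>q\<in>N. W q = ?V q"
    by (rule vfield_extension[OF U(1,2)])
  moreover have "?V p = v" by (rule frame_sum[OF U(3,2) assms])
  ultimately show ?thesis using that[of W] by simp
qed

end

locale affine_manifold = smooth_manifold \<A>
  for \<A> :: "('a::{t2_space, second_countable_topology}, 'n::finite) chart set" +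
  fixes D :: "('a, 'n) covd"
  assumes affine: "affine_connection \<A> D"
begin

section \<open>Global calculus of an affine connection\<close>

lemma covd_smooth:
  "smooth_vfield \<A> UNIV X \<Longrightarrow> smooth_vfield \<A> UNIV V \<Longrightarrow> smooth_vfield \<A> UNIV (D X V)"
  using affine unfolding affine_connection_def by simp

lemma covd_linear_left:
  assumes "smooth_vfield \<A> UNIV X" "smooth_vfield \<A> UNIV Y" "smooth_vfield \<A> UNIV V"
    "smooth_fun \<A> UNIV h" "smooth_fun \<A> UNIV k"
  shows "D (\<lambda>p. h p *\<^sub>R X p + k p *\<^sub>R Y p) V = (\<lambda>p. h p *\<^sub>R D X V p + k p *\<^sub>R D Y V p)"
  using affine assms unfolding affine_connection_def by simp

lemma covd_linear_right:
  assumes "smooth_vfield \<A> UNIV X" "smooth_vfield \<A> UNIV V" "smooth_vfield \<A> UNIV W"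
  shows "D X (\<lambda>p. a *\<^sub>R V p + b *\<^sub>R W p) = (\<lambda>p. a *\<^sub>R D X V p + b *\<^sub>R D X W p)"
  using affine assms unfolding affine_connection_def by simp

lemma covd_leibniz:
  assumes "smooth_vfield \<A> UNIV X" "smooth_vfield \<A> UNIV V" "smooth_fun \<A> UNIV h"
  shows "D X (\<lambda>p. h p *\<^sub>R V p) = (\<lambda>p. differential \<A> h p (X p) *\<^sub>R V p + h p *\<^sub>R D X V p)"
  using affine assms unfolding affine_connection_def by simp

lemma covd_scale_left:
  assumes "smooth_vfield \<A> UNIV X" "smooth_vfield \<A> UNIV V" "smooth_fun \<A> UNIV h"
  shows "D (\<lambda>p. h p *\<^sub>R X p) V = (\<lambda>p. h p *\<^sub>R D X V p)"
  using covd_linear_left[OF assms(1,1,2,3) smooth_fun_const[of _ 0]] by simp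

lemma covd_0_left: "smooth_vfield \<A> UNIV V \<Longrightarrow> D (\<lambda>p. 0) V = (\<lambda>p. 0)"
  using covd_scale_left[OF smooth_vfield_0 _ smooth_fun_const[of _ 0]] by simp

lemma covd_sum_left:
  assumes "smooth_vfield \<A> UNIV V" "\<And>i. smooth_vfield \<A> UNIV (X i)" "\<And>i. smooth_fun \<A> UNIV (h i)"
  shows "D (\<lambda>p. \<Sum>i\<in>I. h i p *\<^sub>R X i p) V = (\<lambda>p. \<Sum>i\<in>I. h i p *\<^sub>R D (X i) V p)"
proof (induction I rule: infinite_finite_induct)
  case (insert j I)
  have "smooth_vfield \<A> UNIV (\<lambda>p. \<Sum>i\<in>I. h i p *\<^sub>R X i p)"
    by (intro smooth_vfield_sum smooth_vfield_scale open_UNIV assms)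
  from covd_linear_left[OF assms(2)[of j] this assms(1) assms(3)[of j] smooth_fun_const[of _ 1]]
  show ?case using insert by simp
qed (simp_all add: covd_0_left[OF assms(1)])

lemma covd_diff_left:
  assumes "smooth_vfield \<A> UNIV X" "smooth_vfield \<A> UNIV Y" "smooth_vfield \<A> UNIV V"
  shows "D (\<lambda>p. X p - Y p) V = (\<lambda>p. D X V p - D Y V p)"
  using covd_linear_left[OF assms smooth_fun_const[of _ 1] smooth_fun_const[of _ "-1"]] by simp

lemma covd_0_right: "smooth_vfield \<A> UNIV X \<Longrightarrow> D X (\<lambda>p. 0) = (\<lambda>p. 0)"
  using covd_linear_right[OF _ smooth_vfield_0 smooth_vfield_0, of X 0 0] by simp

lemma covd_add_right:
  assumes "smooth_vfield \<A> UNIV X" "smooth_vfield \<A> UNIV V" "smooth_vfield \<A> UNIV W"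
  shows "D X (\<lambda>p. V p + W p) = (\<lambda>p. D X V p + D X W p)"
  using covd_linear_right[OF assms, of 1 1] by simp

lemma covd_diff_right:
  assumes "smooth_vfield \<A> UNIV X" "smooth_vfield \<A> UNIV V" "smooth_vfield \<A> UNIV W"
  shows "D X (\<lambda>p. V p - W p) = (\<lambda>p. D X V p - D X W p)"
  using covd_linear_right[OF assms, of 1 "-1"] by simp

lemma covd_sum_right:
  assumes "smooth_vfield \<A> UNIV X" "\<And>i. smooth_vfield \<A> UNIV (V i)"
  shows "D X (\<lambda>p. \<Sum>i\<in>I. V i p) = (\<lambda>p. \<Sum>i\<in>I. D X (V i) p)"
proof (induction I rule: infinite_finite_induct)
  case (insert j I)
  have "smooth_vfield \<A> UNIV (\<lambda>p. \<Sum>i\<in>I. V i p)"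
    by (intro smooth_vfield_sum open_UNIV assms)
  from covd_add_right[OF assms(1) assms(2)[of j] this] show ?case using insert by simp
qed (simp_all add: covd_0_right[OF assms(1)])

section \<open>Locality, tensoriality and covariant derivatives of local fields\<close>

lemma covd_local:
  assumes X: "smooth_vfield \<A> UNIV X" and V: "smooth_vfield \<A> UNIV V" and W: "smooth_vfield \<A> UNIV W"
    and N: "open N" "p \<in> N" "\<And>q. q \<in> N \<Longrightarrow> V q = W q"
  shows "D X V p = D X W p"
proof -
  obtain \<beta> N' K where \<beta>: "smooth_fun \<A> UNIV \<beta>" "open N'" "p \<in> N'" "N' \<subseteq> N"
    "\<forall>q\<in>N'. \<beta> q = (1::real)" "closed K" "K \<subseteq> N" "\<forall>q. q \<notin> K \<longrightarrow> \<beta> q = 0"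
    by (rule smooth_bump_on[OF N(1,2)])
  define Z where "Z q = V q - W q" for q
  have Z: "smooth_vfield \<A> UNIV Z"
    using smooth_vfield_add[OF open_UNIV V smooth_vfield_scale[OF open_UNIV smooth_fun_const[of _ "-1"] W]]
    by (simp add: Z_def[abs_def])
  \<comment> \<open>On \<open>K\<close>, which lies in \<open>N\<close>, the fields agree; off
    \<open>K\<close> the bump vanishes.\<close>
  have "\<beta> q *\<^sub>R Z q = 0" for q
    by (cases "q \<in> K") (use \<beta>(7,8) N(3) in \<open>auto simp: Z_def\<close>)
  then have "(\<lambda>q. \<beta> q *\<^sub>R Z q) = (\<lambda>q. 0)" by (rule ext)
  then have "D X (\<lambda>q. \<beta> q *\<^sub>R Z q) p = 0" using covd_0_right[OF X] by (simp only:)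
  moreover have "\<beta> p = 1" "Z p = 0" using \<beta>(3,5) N(2,3) by (simp_all add: Z_def)
  \<comment> \<open>The Leibniz term with the differential of \<open>\<beta>\<close> drops out since
    \<open>Z p = 0\<close>, and the other has coefficient \<open>\<beta> p = 1\<close>.\<close>
  ultimately have "D X Z p = 0" unfolding covd_leibniz[OF X Z \<beta>(1)] by simp
  then show ?thesis using covd_diff_right[OF X V W] by (simp add: Z_def[abs_def])
qed

text \<open>With a bump function \<open>\<beta>\<close> that is 1 at \<open>p\<close>, the field \<open>\<beta>\<^sup>2 Z\<close> is a combination of the global
  fields \<open>\<beta> e\<^sub>i\<close> with global coefficients \<open>\<beta> Z\<^sup>i\<close>, which vanish at \<open>p\<close> when \<open>Z\<close> does.\<close>

lemma covd_tensorial: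
  assumes X: "smooth_vfield \<A> UNIV X" and Y: "smooth_vfield \<A> UNIV Y" and V: "smooth_vfield \<A> UNIV V"
    and "X p = Y p"
  shows "D X V p = D Y V p"
proof -
  obtain U e where U: "open U" "p \<in> U" "local_frame \<A> U e" by (rule local_frame_at)
  obtain \<beta> N K where "smooth_fun \<A> UNIV \<beta>" "open N" "p \<in> N" "N \<subseteq> U"
    "\<forall>q\<in>N. \<beta> q = (1::real)" "closed K" "K \<subseteq> U" "\<forall>q. q \<notin> K \<longrightarrow> \<beta> q = 0"
    by (rule smooth_bump_on[OF U(1,2)])
  note \<beta> = this(1-4) this(5)[rule_format] this(6,7) this(8)[rule_format]
  define Z where "Z q = X q - Y q" for q
  have Z: "smooth_vfield \<A> UNIV Z"
    using smooth_vfield_add[OF open_UNIV X smooth_vfield_scale[OF open_UNIV smooth_fun_const[of _ "-1"] Y]]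
    by (simp add: Z_def[abs_def])
  define z where "z i q = \<beta> q * frame_coords e q (Z q) $ i" for i q
  define E where "E i q = \<beta> q *\<^sub>R e i q" for i q
  have z: "smooth_fun \<A> UNIV (z i)" for i
    unfolding z_def
    by (rule smooth_fun_extend[OF U(1) \<beta>(6-8,1) frame_coords_smooth[OF U(1,3)
            smooth_vfield_subset[OF Z subset_UNIV]]])
  have E: "smooth_vfield \<A> UNIV (E i)" for i
    unfolding E_def
    by (rule smooth_vfield_extend[OF U(1) \<beta>(6-8,1) local_frame_smooth[OF U(3)]])
  have \<beta>p: "\<beta> p = 1" using \<beta>(3,5) by blast
  have "(\<Sum>i\<in>UNIV. z i q *\<^sub>R E i q) = (\<beta> q * \<beta> q) *\<^sub>R Z q" for q
  proof (cases "q \<in> U")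
    case True
    have "(\<Sum>i\<in>UNIV. z i q *\<^sub>R E i q)
        = (\<beta> q * \<beta> q) *\<^sub>R (\<Sum>i\<in>UNIV. frame_coords e q (Z q) $ i *\<^sub>R e i q)"
      by (simp add: z_def E_def scaleR_sum_right ac_simps)
    then show ?thesis unfolding frame_sum[OF U(3) True smooth_vfieldD[OF Z UNIV_I]] .
  next
    case False
    then have "\<beta> q = 0" using \<beta>(7,8) by blast
    then show ?thesis by (simp add: z_def)
  qed
  then have "D (\<lambda>q. (\<beta> q * \<beta> q) *\<^sub>R Z q) V = (\<lambda>q. \<Sum>i\<in>UNIV. z i q *\<^sub>R D (E i) V q)"
    using covd_sum_left[where X = E and h = z and I = UNIV, OF V E z] by simp
  moreover have "z i p = 0" for i using assms(4) by (simp add: z_def Z_def frame_coords_0)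
  ultimately have "D (\<lambda>q. (\<beta> q * \<beta> q) *\<^sub>R Z q) V p = 0" by simp
  then have "D Z V p = 0"
    using covd_scale_left[OF Z V smooth_fun_mult[OF open_UNIV \<beta>(1,1)]] \<beta>p by simp
  then show ?thesis using covd_diff_left[OF X Y V] by (simp add: Z_def[abs_def])
qed

text \<open>Eliminates the description operator once and for all. Later proofs choose whichever
  extension is convenient, such as a cut-off combination of frame fields or the image of an
  extension under \<open>P\<close>.\<close>

lemma local_covd_eq:
  assumes X: "smooth_vfield \<A> UNIV X" "X p = v"
    and W: "smooth_vfield \<A> UNIV W" "open N" "p \<in> N" "\<And>q. q \<in> N \<Longrightarrow> W q = V q"
  shows "local_covd \<A> D p v V = D X W p"
  unfolding local_covd_def
proof (rule the_equality)
  show "\<exists>X' W' N. smooth_vfield \<A> UNIV X' \<and> X' p = v \<and> smooth_vfield \<A> UNIV W' \<and> open N \<and> p \<in> N \<and>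
      (\<forall>q\<in>N. W' q = V q) \<and> D X W p = D X' W' p"
    by (rule exI[of _ X], rule exI[of _ W], rule exI[of _ N]) (simp add: assms)
  fix w
  assume "\<exists>X W N. smooth_vfield \<A> UNIV X \<and> X p = v \<and> smooth_vfield \<A> UNIV W \<and> open N \<and> p \<in> N \<and>
      (\<forall>q\<in>N. W q = V q) \<and> w = D X W p"
  then obtain X' W' N' where X': "smooth_vfield \<A> UNIV X'" "X' p = v"
    and W': "smooth_vfield \<A> UNIV W'" "open N'" "p \<in> N'" "\<And>q. q \<in> N' \<Longrightarrow> W' q = V q"
    and w: "w = D X' W' p"
    by (elim exE conjE) (rule that, auto)
  \<comment> \<open>The direction is exchanged first, with the field fixed; then the field, on the
    intersection of the two neighbourhoods.\<close>
  have "D X' W' p = D X W' p"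
    by (rule covd_tensorial[OF X'(1) X(1) W'(1)]) (simp add: X(2) X'(2))
  also have "\<dots> = D X W p"
    by (rule covd_local[OF X(1) W'(1) W(1), where N = "N \<inter> N'"])
      (use W W' in \<open>auto simp: open_Int\<close>)
  finally show "w = D X W p" using w by simp
qed

lemma local_covd_extensions:
  assumes "open U" "p \<in> U" "smooth_vfield \<A> U V" "v \<in> tangent_space \<A> p"
  obtains X W N where "smooth_vfield \<A> UNIV X" "X p = v" "smooth_vfield \<A> UNIV W" "open N" "p \<in> N"
    "N \<subseteq> U" "\<forall>q\<in>N. W q = V q"
proof -
  obtain X where X: "smooth_vfield \<A> UNIV X" "X p = v" by (rule tangent_extension[OF assms(4)])
  obtain W N where "smooth_vfield \<A> UNIV W" "open N" "p \<in> N" "\<forall>q\<in>N. W q = V q"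
    by (rule vfield_extension[OF assms(1-3)])
  then show ?thesis using that[OF X, of W "N \<inter> U"] assms(1,2) by (simp add: open_Int)
qed

lemma local_covd_in:
  assumes "open U" "p \<in> U" "smooth_vfield \<A> U V" "v \<in> tangent_space \<A> p"
  shows "local_covd \<A> D p v V \<in> tangent_space \<A> p"
proof -
  obtain X W N where XW: "smooth_vfield \<A> UNIV X" "X p = v" "smooth_vfield \<A> UNIV W" "open N" "p \<in> N"
    "N \<subseteq> U" "\<forall>q\<in>N. W q = V q"
    by (rule local_covd_extensions[OF assms])
  have "local_covd \<A> D p v V = D X W p"
    by (rule local_covd_eq[OF XW(1-5)]) (simp add: XW(7))
  then show ?thesis using smooth_vfieldD[OF covd_smooth[OF XW(1,3)] UNIV_I] by simp
qed

text \<open>Both sides have a common extension. Off \<open>U\<close> nothing is known about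
  \<open>V'\<close>, which matters for frame expansions: they reproduce a field only on the domain
  of the frame.\<close>

lemma local_covd_cong:
  assumes "open U" "p \<in> U" "smooth_vfield \<A> U V" "v \<in> tangent_space \<A> p"
    and "\<And>q. q \<in> U \<Longrightarrow> V q = V' q"
  shows "local_covd \<A> D p v V = local_covd \<A> D p v V'"
proof -
  obtain X W N where XW: "smooth_vfield \<A> UNIV X" "X p = v" "smooth_vfield \<A> UNIV W" "open N" "p \<in> N"
    "N \<subseteq> U" "\<forall>q\<in>N. W q = V q"
    by (rule local_covd_extensions[OF assms(1-4)])
  have "local_covd \<A> D p v V = D X W p"
    by (rule local_covd_eq[OF XW(1-5)]) (simp add: XW(7))
  moreover have "local_covd \<A> D p v V' = D X W p"
    by (rule local_covd_eq[OF XW(1-5)]) (use XW(6,7) assms(5) in auto)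
  ultimately show ?thesis by simp
qed

text \<open>Coefficients and fields are cut off separately, so that the global Leibniz rule meets a
  global function and a global field. Near \<open>p\<close> the bump is 1, hence neither the values
  nor the differentials at \<open>p\<close> change.\<close>

lemma local_covd_sum:
  assumes U: "open U" "p \<in> U" and e: "\<And>i. smooth_vfield \<A> U (e i)" and a: "\<And>i. smooth_fun \<A> U (a i)"
    and v: "v \<in> tangent_space \<A> p"
  shows "local_covd \<A> D p v (\<lambda>q. \<Sum>i\<in>I. a i q *\<^sub>R e i q)
    = (\<Sum>i\<in>I. differential \<A> (a i) p v *\<^sub>R e i p + a i p *\<^sub>R local_covd \<A> D p v (e i))"
proof -
  obtain X where X: "smooth_vfield \<A> UNIV X" "X p = v" by (rule tangent_extension[OF v])
  obtain \<beta> N K where "smooth_fun \<A> UNIV \<beta>" "open N" "p \<in> N" "N \<subseteq> U"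
    "\<forall>q\<in>N. \<beta> q = (1::real)" "closed K" "K \<subseteq> U" "\<forall>q. q \<notin> K \<longrightarrow> \<beta> q = 0"
    by (rule smooth_bump_on[OF U])
  note \<beta> = this(1-4) this(5)[rule_format] this(6,7) this(8)[rule_format]
  define A where "A i q = \<beta> q * a i q" for i q
  define E where "E i q = \<beta> q *\<^sub>R e i q" for i q
  have A: "smooth_fun \<A> UNIV (A i)" for i
    unfolding A_def by (rule smooth_fun_extend[OF U(1) \<beta>(6-8,1) a])
  have E: "smooth_vfield \<A> UNIV (E i)" for i
    unfolding E_def by (rule smooth_vfield_extend[OF U(1) \<beta>(6-8,1) e])
  have AE: "smooth_vfield \<A> UNIV (\<lambda>q. A i q *\<^sub>R E i q)" for i
    by (rule smooth_vfield_scale[OF open_UNIV A E])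
  have S: "smooth_vfield \<A> UNIV (\<lambda>q. \<Sum>i\<in>I. A i q *\<^sub>R E i q)"
    by (rule smooth_vfield_sum[OF open_UNIV AE])
  have "local_covd \<A> D p v (\<lambda>q. \<Sum>i\<in>I. a i q *\<^sub>R e i q) = D X (\<lambda>q. \<Sum>i\<in>I. A i q *\<^sub>R E i q) p"
    by (rule local_covd_eq[OF X S \<beta>(2,3)]) (simp add: A_def E_def \<beta>(5))
  also have "\<dots> = (\<Sum>i\<in>I. differential \<A> (A i) p v *\<^sub>R E i p + A i p *\<^sub>R D X (E i) p)"
    by (simp add: covd_sum_right[OF X(1) AE] covd_leibniz[OF X(1) E A] X(2))
  also have "\<dots> = (\<Sum>i\<in>I. differential \<A> (a i) p v *\<^sub>R e i p + a i p *\<^sub>R local_covd \<A> D p v (e i))"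
  proof (rule sum.cong[OF refl])
    fix i
    have "local_covd \<A> D p v (e i) = D X (E i) p"
      by (rule local_covd_eq[OF X E \<beta>(2,3)]) (simp add: E_def \<beta>(5))
    moreover have "differential \<A> (A i) p v = differential \<A> (a i) p v"
      by (rule differential_cong[OF \<beta>(2,3)])
        (use \<beta>(5) smooth_fun_subset[OF a \<beta>(4)] in \<open>simp_all add: A_def smooth_fun_iff\<close>)
    moreover have "A i p = a i p" "E i p = e i p" using \<beta>(3,5) by (simp_all add: A_def E_def)
    ultimately show "differential \<A> (A i) p v *\<^sub>R E i p + A i p *\<^sub>R D X (E i) p
        = differential \<A> (a i) p v *\<^sub>R e i p + a i p *\<^sub>R local_covd \<A> D p v (e i)" by simp
  qed
  finally show ?thesis .
qed

text \<open>The component formula dV + \<Gamma> V for a covariant derivative. It is used twice: for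
  the reference connection on the fields \<open>P e\<^sub>j\<close> it yields the transformation
  law, for the deformed connection on \<open>V\<close> the parallel condition.\<close>

lemma frame_coords_local_covd:
  assumes U: "open U" "p \<in> U" and e: "local_frame \<A> U e" and V: "smooth_vfield \<A> U V"
    and v: "v \<in> tangent_space \<A> p"
  shows "frame_coords e p (local_covd \<A> D p v V)
    = differential \<A> (\<lambda>q. frame_coords e q (V q)) p v
      + connection_form \<A> D e p v *v frame_coords e p (V p)"
proof -
  let ?a = "\<lambda>i q. frame_coords e q (V q) $ i"
  have a: "smooth_fun \<A> U (?a i)" for i by (rule frame_coords_smooth[OF U(1) e V])
  have e_in: "e i p \<in> tangent_space \<A> p" for i
    by (rule smooth_vfieldD[OF local_frame_smooth[OF e] U(2)])
  have cov_in: "local_covd \<A> D p v (e i) \<in> tangent_space \<A> p" for i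
    by (rule local_covd_in[OF U local_frame_smooth[OF e] v])
  have "chart_smooth c U (\<lambda>q. frame_coords e q (V q))" if "c \<in> \<A>" for c
    by (rule chart_smooth_vec[OF that U(1)]) (use a that in \<open>simp add: smooth_fun_iff\<close>)
  from differential_bounded_linear[OF bounded_linear_vec_nth U(2) this]
  have d: "differential \<A> (?a i) p v = differential \<A> (\<lambda>q. frame_coords e q (V q)) p v $ i" for i .
  have "local_covd \<A> D p v V = local_covd \<A> D p v (\<lambda>q. \<Sum>i\<in>UNIV. ?a i q *\<^sub>R e i q)"
    by (rule local_covd_cong[OF U V v])
      (rule frame_sum[OF e _ smooth_vfieldD[OF V], symmetric])
  also have "\<dots> = (\<Sum>i\<in>UNIV. differential \<A> (?a i) p v *\<^sub>R e i p + ?a i p *\<^sub>R local_covd \<A> D p v (e i))"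
    by (rule local_covd_sum[OF U local_frame_smooth[OF e] a v])
  finally have "frame_coords e p (local_covd \<A> D p v V) = (\<Sum>i\<in>UNIV.
      differential \<A> (?a i) p v *\<^sub>R axis i 1 + ?a i p *\<^sub>R frame_coords e p (local_covd \<A> D p v (e i)))"
    by (simp add: frame_coords_sum[OF e U(2)] frame_coords_add[OF e U(2)] tangent_space_add
        tangent_space_scale e_in cov_in frame_coords_scale[OF e U(2)] frame_coords_basis[OF e U(2)])
  then show ?thesis
    by (simp add: vec_eq_iff connection_form_def matrix_vector_mult_def sum.distrib axis_def d
        mult.commute if_distrib[of "\<lambda>x. _ * x"] if_distrib[of "\<lambda>x. x * _"] cong: if_cong)
qed

section \<open>The deformed connection\<close>

context
  fixes P :: "('a, 'n) endo_field"
  assumes P: "deformation_field \<A> P"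
begin

text \<open>In this locale \<open>D\<close> is the reference connection, called \<open>Dbar\<close>
  in the theorem; \<open>DP\<close> corresponds to the \<open>D\<close> of the theorem.\<close>

abbreviation "DP \<equiv> deformed_connection \<A> P D"

lemma reference_rep_smooth:
  "smooth_vfield \<A> UNIV V \<Longrightarrow> smooth_vfield \<A> UNIV (reference_rep P V)"
  by (rule deformation_smooth[OF P open_UNIV])

lemma reference_rep_linear:
  assumes "smooth_vfield \<A> UNIV V" "smooth_vfield \<A> UNIV W"
  shows "reference_rep P (\<lambda>p. a *\<^sub>R V p + b *\<^sub>R W p)
    = (\<lambda>p. a *\<^sub>R reference_rep P V p + b *\<^sub>R reference_rep P W p)"
  by (rule ext) (simp add: reference_rep_def deformation_linear[OF P] smooth_vfieldD[OF assms(1)]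
      smooth_vfieldD[OF assms(2)])

lemma reference_rep_scale:
  assumes "smooth_vfield \<A> UNIV V"
  shows "reference_rep P (\<lambda>p. h p *\<^sub>R V p) = (\<lambda>p. h p *\<^sub>R reference_rep P V p)"
  by (rule ext) (simp add: reference_rep_def deformation_scale[OF P] smooth_vfieldD[OF assms])

lemma affine_deformed: "affine_connection \<A> DP"
  unfolding affine_connection_def
proof (intro conjI allI impI; elim conjE)
  note smoothD = smooth_vfieldD[OF _ UNIV_I]
  note inv_linear = deformation_inv_linear[OF P]
  fix X V :: "('a, 'n) vfield"
  assume X: "smooth_vfield \<A> UNIV X" and V: "smooth_vfield \<A> UNIV V"
  note PV = reference_rep_smooth[OF V]
  have DX: "D X (reference_rep P V) p \<in> tangent_space \<A> p" for p
    by (rule smoothD[OF covd_smooth[OF X PV]])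
  show "smooth_vfield \<A> UNIV (DP X V)"
    using deformation_inv_smooth[OF P open_UNIV covd_smooth[OF X PV]]
    by (simp add: deformed_connection_def)
  {
    fix W :: "('a, 'n) vfield" and a b :: real
    assume W: "smooth_vfield \<A> UNIV W"
    note PW = reference_rep_smooth[OF W]
    have DW: "D X (reference_rep P W) p \<in> tangent_space \<A> p" for p
      by (rule smoothD[OF covd_smooth[OF X PW]])
    show "DP X (\<lambda>p. a *\<^sub>R V p + b *\<^sub>R W p) = (\<lambda>p. a *\<^sub>R DP X V p + b *\<^sub>R DP X W p)"
      by (rule ext) (simp add: deformed_connection_def reference_rep_linear[OF V W]
          covd_linear_right[OF X PV PW] inv_linear[OF DX DW])
  next
    fix Y :: "('a, 'n) vfield" and h k
    assume Y: "smooth_vfield \<A> UNIV Y" and hk: "smooth_fun \<A> UNIV h" "smooth_fun \<A> UNIV k"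
    have DY: "D Y (reference_rep P V) p \<in> tangent_space \<A> p" for p
      by (rule smoothD[OF covd_smooth[OF Y PV]])
    show "DP (\<lambda>p. h p *\<^sub>R X p + k p *\<^sub>R Y p) V = (\<lambda>p. h p *\<^sub>R DP X V p + k p *\<^sub>R DP Y V p)"
      by (rule ext) (simp add: deformed_connection_def covd_linear_left[OF X Y PV hk]
          inv_linear[OF DX DY])
  next
    fix h
    assume h: "smooth_fun \<A> UNIV h"
    \<comment> \<open>In the Leibniz rule the differential of \<open>h\<close> multiplies
      \<open>P V\<close>; the inverse of \<open>P\<close> turns this back into
      \<open>V\<close>.\<close>
    have inv_PV: "deformation_inv P p (reference_rep P V p) = V p" for p
      unfolding reference_rep_def by (rule deformation_inv_left[OF P smoothD[OF V]])
    show "DP X (\<lambda>p. h p *\<^sub>R V p) = (\<lambda>p. differential \<A> h p (X p) *\<^sub>R V p + h p *\<^sub>R DP X V p)"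
      by (rule ext) (simp add: deformed_connection_def reference_rep_scale[OF V]
          covd_leibniz[OF X PV h] inv_linear[OF smoothD[OF PV] DX] inv_PV)
  }
qed

text \<open>\<open>P\<close> acts pointwise, so if \<open>W\<close> extends \<open>V\<close> near
  \<open>p\<close>, then \<open>P W\<close> extends \<open>P V\<close> there. One choice of
  extension therefore computes both sides, and the inverse of \<open>P\<close> in the definition
  cancels.\<close>

lemma local_covd_deformed:
  assumes "open U" "p \<in> U" "smooth_vfield \<A> U V" "v \<in> tangent_space \<A> p"
  shows "P p (local_covd \<A> DP p v V) = local_covd \<A> D p v (reference_rep P V)"
proof -
  interpret deformed: affine_manifold \<A> DP
    by unfold_locales (rule affine_deformed)
  obtain X W N where XW: "smooth_vfield \<A> UNIV X" "X p = v" "smooth_vfield \<A> UNIV W" "open N" "p \<in> N"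
    "N \<subseteq> U" "\<forall>q\<in>N. W q = V q"
    by (rule local_covd_extensions[OF assms])
  note PW = reference_rep_smooth[OF XW(3)]
  have "local_covd \<A> DP p v V = DP X W p"
    by (rule deformed.local_covd_eq[OF XW(1-5)]) (simp add: XW(7))
  moreover have "local_covd \<A> D p v (reference_rep P V) = D X (reference_rep P W) p"
    by (rule local_covd_eq[OF XW(1,2) PW XW(4,5)]) (simp add: XW(7) reference_rep_def)
  moreover have "P p (DP X W p) = D X (reference_rep P W) p"
    unfolding deformed_connection_def
    by (rule deformation_inv_right[OF P smooth_vfieldD[OF covd_smooth[OF XW(1) PW] UNIV_I]])
  ultimately show ?thesis by simp
qed

section \<open>The deformation in frames and the transformation law\<close>

lemma frame_coords_deformation:
  assumes "local_frame \<A> U f" "local_frame \<A> U e" "p \<in> U" "w \<in> tangent_space \<A> p"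
  shows "frame_coords f p (P p w) = frame_matrix f e P p *v frame_coords e p w"
proof -
  have e_in: "e i p \<in> tangent_space \<A> p" for i
    by (rule smooth_vfieldD[OF local_frame_smooth[OF assms(2)] assms(3)])
  have "frame_coords f p (P p w)
      = frame_coords f p (P p (\<Sum>i\<in>UNIV. frame_coords e p w $ i *\<^sub>R e i p))"
    unfolding frame_sum[OF assms(2-4)] ..
  also have "\<dots> = (\<Sum>i\<in>UNIV. frame_coords e p w $ i *\<^sub>R frame_coords f p (P p (e i p)))"
    by (simp add: deformation_sum[OF P] deformation_scale[OF P] tangent_space_scale e_in
        deformation_in[OF P] frame_coords_sum[OF assms(1,3)] frame_coords_scale[OF assms(1,3)])
  finally show ?thesis
    by (simp add: vec_eq_iff frame_matrix_def matrix_vector_mult_def mult.commute)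
qed

lemma invertible_frame_matrix:
  assumes "local_frame \<A> U f" "local_frame \<A> U e" "p \<in> U"
  shows "invertible (frame_matrix f e P p)"
  unfolding invertible_det_nz
proof (rule det_nz_if_inj)
  fix x :: "real ^ 'n"
  assume 0: "frame_matrix f e P p *v x = 0"
  let ?w = "\<Sum>i\<in>UNIV. x $ i *\<^sub>R e i p"
  have w: "?w \<in> tangent_space \<A> p"
    by (intro tangent_space_sum tangent_space_scale
        smooth_vfieldD[OF local_frame_smooth[OF assms(2)] assms(3)])
  have x: "frame_coords e p ?w = x"
    unfolding frame_coords_of_sum[OF assms(2,3), of "\<lambda>i. x $ i"] by simp
  have "frame_coords f p (P p ?w) = 0"
    unfolding frame_coords_deformation[OF assms w] x by (rule 0)
  then have "?w = 0"
    unfolding frame_coords_eq_0_iff[OF assms(1,3) deformation_in[OF P w]]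
    by (rule deformation_eq_0D[OF P w])
  then show "x = 0" using x by (simp add: frame_coords_0)
qed

lemma frame_matrix_smooth:
  assumes "open U" "local_frame \<A> U f" "local_frame \<A> U e"
  shows "smooth_fun \<A> U (\<lambda>q. frame_matrix f e P q $ i $ j)"
  using frame_coords_smooth[OF assms(1,2) deformation_smooth[OF P assms(1) local_frame_smooth[OF assms(3)]]]
  by (simp add: frame_matrix_def reference_rep_def)

lemma frame_matrix_connection_form:
  assumes U: "open U" "p \<in> U" and f: "local_frame \<A> U f" and e: "local_frame \<A> U e"
    and v: "v \<in> tangent_space \<A> p"
  shows "frame_matrix f e P p ** connection_form \<A> DP e p v
    = connection_form \<A> D f p v ** frame_matrix f e P p + differential \<A> (frame_matrix f e P) p v"
proof -
  interpret deformed: affine_manifold \<A> DP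
    by unfold_locales (rule affine_deformed)
  let ?M = "frame_matrix f e P"
  let ?Pe = "\<lambda>j. reference_rep P (e j)"
  have Pe: "smooth_vfield \<A> U (?Pe j)" for j
    by (rule deformation_smooth[OF P U(1) local_frame_smooth[OF e]])
  have M_smooth: "chart_smooth c U ?M" if "c \<in> \<A>" for c
    by (intro chart_smooth_vec[OF that U(1)])
      (use frame_matrix_smooth[OF U(1) f e] that in \<open>simp add: smooth_fun_iff\<close>)
  have col_smooth: "chart_smooth c U (\<lambda>q. frame_coords f q (?Pe j q))" if "c \<in> \<A>" for c j
    by (rule chart_smooth_vec[OF that U(1)])
      (use frame_coords_smooth[OF U(1) f Pe] that in \<open>simp add: smooth_fun_iff\<close>)
  have entry: "bounded_linear (\<lambda>m :: real ^ 'n ^ 'n. m $ i $ j)" for i j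
    by (rule bounded_linear_compose[OF bounded_linear_vec_nth bounded_linear_vec_nth])
  \<comment> \<open>The differential of column j is column j of the matrix differential; both are
    compared with the differential of the scalar entry.\<close>
  have dM: "differential \<A> (\<lambda>q. frame_coords f q (?Pe j q)) p v $ i = differential \<A> ?M p v $ i $ j"
    for i j
  proof -
    have "differential \<A> (\<lambda>q. frame_coords f q (?Pe j q)) p v $ i
        = differential \<A> (\<lambda>q. frame_coords f q (?Pe j q) $ i) p v"
      by (rule differential_bounded_linear[OF bounded_linear_vec_nth U(2) col_smooth, symmetric])
    also have "(\<lambda>q. frame_coords f q (?Pe j q) $ i) = (\<lambda>q. ?M q $ i $ j)"
      by (simp add: frame_matrix_def reference_rep_def)
    also have "differential \<A> (\<lambda>q. ?M q $ i $ j) p v = differential \<A> ?M p v $ i $ j"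
      by (rule differential_bounded_linear[OF entry U(2) M_smooth])
    finally show ?thesis .
  qed
  \<comment> \<open>This is column j of the claim: the left side gives the
    \<open>f\<close>-components of \<open>P\<close> applied to the deformed derivative of
    \<open>e\<^sub>j\<close>, the right side those of the reference derivative of
    \<open>P e\<^sub>j\<close>.\<close>
  have col: "?M p *v frame_coords e p (local_covd \<A> DP p v (e j))
      = differential \<A> (\<lambda>q. frame_coords f q (?Pe j q)) p v
        + connection_form \<A> D f p v *v frame_coords f p (?Pe j p)" for j
    unfolding frame_coords_local_covd[OF U f Pe v, symmetric]
      local_covd_deformed[OF U local_frame_smooth[OF e] v, symmetric]
    by (rule frame_coords_deformation[OF f e U(2)
          deformed.local_covd_in[OF U local_frame_smooth[OF e] v], symmetric])
  have "(?M p ** connection_form \<A> DP e p v) $ i $ j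
      = (?M p *v frame_coords e p (local_covd \<A> DP p v (e j))) $ i" for i j
    by (simp add: connection_form_def matrix_matrix_mult_def matrix_vector_mult_def)
  moreover have "(connection_form \<A> D f p v ** ?M p) $ i $ j
      = (connection_form \<A> D f p v *v frame_coords f p (?Pe j p)) $ i" for i j
    by (simp add: frame_matrix_def reference_rep_def matrix_matrix_mult_def matrix_vector_mult_def)
  ultimately show ?thesis by (simp add: vec_eq_iff col dM)
qed

lemma connection_form_deformed:
  assumes "open U" "p \<in> U" "local_frame \<A> U f" "local_frame \<A> U e" "v \<in> tangent_space \<A> p"
  shows "connection_form \<A> DP e p v
    = matrix_inv (frame_matrix f e P p) ** connection_form \<A> D f p v ** frame_matrix f e P p
      + matrix_inv (frame_matrix f e P p) ** differential \<A> (frame_matrix f e P) p v"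
proof -
  let ?M = "frame_matrix f e P p"
  have "matrix_inv ?M ** ?M = mat 1"
    by (rule matrix_inv_left[OF invertible_frame_matrix[OF assms(3,4,2)]])
  then have "connection_form \<A> DP e p v = matrix_inv ?M ** (?M ** connection_form \<A> DP e p v)"
    by (simp add: matrix_mul_assoc)
  then show ?thesis
    unfolding frame_matrix_connection_form[OF assms]
    by (simp add: matrix_add_ldistrib matrix_mul_assoc)
qed

text \<open>The equivalence holds at each point and in each direction separately; the quantified
  version in the theorem follows by congruence.\<close>

lemma parallel_deformed_iff:
  assumes "open U" "p \<in> U" "local_frame \<A> U e" "smooth_vfield \<A> U V" "v \<in> tangent_space \<A> p"
  shows "local_covd \<A> D p v (reference_rep P V) = 0 \<longleftrightarrow>
    differential \<A> (\<lambda>q. frame_coords e q (V q)) p v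
      + connection_form \<A> DP e p v *v frame_coords e p (V p) = 0"
proof -
  interpret deformed: affine_manifold \<A> DP
    by unfold_locales (rule affine_deformed)
  let ?w = "local_covd \<A> DP p v V"
  have w: "?w \<in> tangent_space \<A> p" by (rule deformed.local_covd_in[OF assms(1,2,4,5)])
  have "P p ?w = 0 \<longleftrightarrow> ?w = 0"
    using deformation_eq_0D[OF P w] deformation_0[OF P] by auto
  then show ?thesis
    unfolding local_covd_deformed[OF assms(1,2,4,5), symmetric]
      deformed.frame_coords_local_covd[OF assms, symmetric]
      frame_coords_eq_0_iff[OF assms(3,2) w] .
qed

end

end

theorem proposition3p2:
  fixes \<A> :: "('a::{t2_space, second_countable_topology}, 'n::finite) chart set"
    and gbar g :: "'a \<Rightarrow> ('a, 'n) tvec \<Rightarrow> ('a, 'n) tvec \<Rightarrow> real"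
    and \<D> :: "('a, 'n) endo_field set"
    and P :: "('a, 'n) endo_field"
    and Dbar D :: "('a, 'n) covd"
  assumes "smooth_atlas \<A>"
    and "pseudo_riemannian_metric \<A> gbar"
    and "affine_connection \<A> Dbar"
    and "admissible \<A> gbar \<D> P"
    and "g = induced_metric gbar P"
    and "D = deformed_connection \<A> P Dbar"
  shows "affine_connection \<A> D \<and>
    (\<forall>U f e. open U \<and> local_frame \<A> U f \<and> local_frame \<A> U e \<longrightarrow>
      (let M = frame_matrix f e P;
           \<Gamma>bar = connection_form \<A> Dbar f;
           \<Gamma> = connection_form \<A> D e;
           \<Lambda> = compensation \<A> P Dbar e
       in (\<forall>p\<in>U. invertible (M p)) \<and>
          (\<forall>p\<in>U. \<forall>v\<in>tangent_space \<A> p.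
             \<Gamma> p v = matrix_inv (M p) ** \<Gamma>bar p v ** M p
                      + matrix_inv (M p) ** differential \<A> M p v) \<and>
          (\<forall>p\<in>U. \<forall>v\<in>tangent_space \<A> p. \<Gamma> p v = \<Lambda> p v) \<and>
          (\<forall>V. smooth_vfield \<A> U V \<longrightarrow>
             (let Vc = (\<lambda>q. frame_coords e q (V q))
              in (\<forall>p\<in>U. \<forall>v\<in>tangent_space \<A> p.
                    local_covd \<A> Dbar p v (reference_rep P V) = 0) \<longleftrightarrow>
                 (\<forall>p\<in>U. \<forall>v\<in>tangent_space \<A> p.
                    differential \<A> Vc p v + \<Gamma> p v *v Vc p = 0)))))"
proof -
  interpret affine_manifold \<A> Dbar
    by unfold_locales (rule assms(1), rule assms(3))
  have P: "deformation_field \<A> P" using assms(4) unfolding admissible_def by simp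
  show ?thesis
    \<comment> \<open>Unfolding \<open>compensation\<close> turns the clause \<Gamma> = \<Lambda>
      into a reflexive equation, which the closing \<open>refl\<close> discharges.\<close>
    unfolding Let_def assms(6) compensation_def
  proof (intro conjI allI impI ballI; (elim conjE)?)
    show "affine_connection \<A> (deformed_connection \<A> P Dbar)" by (rule affine_deformed[OF P])
    fix U f e assume U: "open U" and f: "local_frame \<A> U f" and e: "local_frame \<A> U e"
    show "invertible (frame_matrix f e P p)" if "p \<in> U" for p
      by (rule invertible_frame_matrix[OF P f e that])
    show "connection_form \<A> (deformed_connection \<A> P Dbar) e p v
        = matrix_inv (frame_matrix f e P p) ** connection_form \<A> Dbar f p v ** frame_matrix f e P p
          + matrix_inv (frame_matrix f e P p) ** differential \<A> (frame_matrix f e P) p v"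
      if "p \<in> U" "v \<in> tangent_space \<A> p" for p v
      by (rule connection_form_deformed[OF P U that(1) f e that(2)])
    fix V assume V: "smooth_vfield \<A> U V"
    show "(\<forall>p\<in>U. \<forall>v\<in>tangent_space \<A> p. local_covd \<A> Dbar p v (reference_rep P V) = 0) \<longleftrightarrow>
        (\<forall>p\<in>U. \<forall>v\<in>tangent_space \<A> p. differential \<A> (\<lambda>q. frame_coords e q (V q)) p v
          + connection_form \<A> (deformed_connection \<A> P Dbar) e p v *v frame_coords e p (V p) = 0)"
      by (intro ball_cong refl parallel_deformed_iff[OF P U _ e V])
  qed (rule refl)
qed

end
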